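(* Let $\{X_k\}_{k\ge0}$ be a sequence of iterates produced by the Jacobi-GLU or the Jacobi-GQU algorithm (defined in the context) for the cost function $g(X)=\sum_{\ell=1}^{L}\|\mathrm{offdiag}\{X^{S}B^{(\ell)}X\}\|^2$ on $\mathrm{SL}_m(\mathbb C)$, where $S\in\{T,H\}$ is fixed. Assume that the iterates are bounded, i.e. there is a constant $M_X>0$ such that $\|X_k\|\le M_X$ for all $k\ge1$. If $X_*$ is an accumulation point of $\{X_k\}_{k\ge1}$, then $X_*$ is a stationary point of $g$ on $\mathrm{SL}_m(\mathbb C)$, i.e. $\mathrm{grad}\,g(X_* )=0$.
   Context: **Problem.** Let $m\ge2$, $L\ge1$ be integers and $B^{(1)},\dots,B^{(L)}\in\mathbb C^{m\times m}$. Fix $S\in\{T,H\}$, so that $(\cdot)^{S}$ is either the transpose $(\cdot)^{T}$ or the conjugate transpose $(\cdot)^{H}$. $\mathrm{offdiag}\{W\}$ is $W$ with its diagonal set to zero; $\|\cdot\|$ is the Frobenius norm; $\mathrm{SL}_m(\mathbb C)=\{X\in\mathbb C^{m\times m}:\det X=1\}$. **Gradient.** $\nabla g=\partial g/\partial X^{\Re}+i\,\partial g/\partial X^{\Im}$ is the Euclidean gradient (of $g$ extended to $\mathbb C^{m\times m}$ by the same formula). $\mathrm{grad}\,g(X)=X\Lambda(X)$ with $\Lambda(X)=X^H\nabla g(X)-\frac{\mathrm{tr}(X^H\nabla g(X))}{m}I_m$; this is the Riemannian gradient for the left-invariant metric $\langle V_1,V_2\rangle_X=\mathrm{Re}\,\mathrm{tr}((X^{-1}V_1)^HX^{-1}V_2)$.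 **Elementary functions.** For $i<j$ and $\Psi\in\mathbb C^{2\times2}$, $\mathcal E_{i,j}(\Psi)\in\mathbb C^{m\times m}$ is the identity matrix except that its $(i,i),(i,j),(j,i),(j,j)$ entries are $\Psi_{11},\Psi_{12},\Psi_{21},\Psi_{22}$. For given $X$, $(i,j)$ and $z=x+iy$, set $h(\Psi)=g(X\mathcal E_{i,j}(\Psi))$, and denote it - $h^{(U)}(x,y)$ when $\Psi=\begin{bmatrix}1 & z \\ 0 & 1\end{bmatrix}$; $h^{(L)}(x,y)$ when $\Psi=\begin{bmatrix}1 & 0 \\ z & 1\end{bmatrix}$; $h^{(D)}(x,y)$ when $\Psi=\begin{bmatrix}z & 0 \\ 0 & 1/z\end{bmatrix}$, $z\ne0$; - $h^{(Q)}(c,s_1,s_2)$ when $\Psi=\begin{bmatrix}c & -(s_1+is_2) \\ s_1-is_2 & c\end{bmatrix}$, $c^2+s_1^2+s_2^2=1$; also $c=\cos\theta$, $s_1=\sin\theta\cos\phi$, $s_2=\sin\theta\sin\phi$. $\partial h(I_2)$ is the gradient at the parameter giving $\Psi=I_2$: $(\partial_x,\partial_y)$ at $(0,0)$ for $U,L$ and at $(1,0)$ for $D$; the gradient on the unit sphere at $(1,0,0)$ for $Q$. **Algorithm.** Fix constants $0<\varsigma_D<1/4$, $0<\varsigma_Q\le1$ and $\varepsilon$ (below), and a starting point $X_0\in\mathrm{SL}_m(\mathbb C)$. At iteration $k\ge1$: if $\mathrm{grad}\,g(X_{k-1})=0$, then $X_k=X_{k-1}$. Otherwise, with $X=X_{k-1}$,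 choose a pair $i<j$ and an elementary function $h$ of an allowed type with $\|\partial h(I_2)\|\ge\varepsilon\|\Lambda(X_{k-1})\|$, and set $X_k=X_{k-1}\mathcal E_{i,j}(\Psi_k^* )$. Allowed types: Jacobi-GLU: $U,L,D$ with $0<\varepsilon<\sqrt{\frac{2}{3m(m-1)}}$; Jacobi-GQU: $Q,U,D$ with $0<\varepsilon<\sqrt{\frac{3-\sqrt5}{3m(m-1)}}$. Let $W^{(\ell)}=X^{S}B^{(\ell)}X$. The matrix $\Psi_k^*$ is: - Type $U$ or $L$: $(x,y)$ is the minimizer of the quadratic polynomial $h$ over $\mathbb R^2$; if $h$ is constant, $(x,y)=(0,0)$. - Type $D$: $y=0$. Let $\gamma_1=\sum_\ell\sum_{p\ne i,j}(|W^{(\ell)}_{ip}|^2+|W^{(\ell)}_{pi}|^2)$, $\gamma_2=\sum_\ell\sum_{p\ne i,j}(|W^{(\ell)}_{jp}|^2+|W^{(\ell)}_{pj}|^2)$. If $\gamma_1=\gamma_2=0$, $x=1$. Otherwise let $\varpi=\gamma_2/\gamma_1\in[0,+\infty]$: $x=1/2$ if $\varpi<\varsigma_D$; $x=2$ if $\varpi>1/\varsigma_D$; $x=\varpi^{1/4}$ otherwise. - Type $Q$: let $\varrho=1$ and $\mathbf z(W)=[W_{jj}-W_{ii},\ W_{ij}+W_{ji},\ -i(W_{ij}-W_{ji})]^T$ if $S=H$; $\varrho=-1$ and $\mathbf z(W)=[W_{ij}+W_{ji},\ W_{ii}-W_{jj},\ i(W_{ii}+W_{jj})]^T$ if $S=T$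 (the factor $i$ multiplying brackets is the imaginary unit). Let $\Gamma=\frac{\varrho}{2}\sum_\ell\mathrm{Re}(\mathbf z(W^{(\ell)})\mathbf z(W^{(\ell)})^H)\in\mathbb R^{3\times3}$ and $r(\theta,\phi)=[\cos2\theta,-\sin2\theta\cos\phi,-\sin2\theta\sin\phi]^T$; one has $h^{(Q)}(\theta,\phi)-h^{(Q)}(0,0)=-(r^T\Gamma r-\Gamma_{11})$. Let $u$ be a unit eigenvector of $\Gamma$ for its largest eigenvalue with $u_1\ge0$, $v=[\Gamma_{12},\Gamma_{13}]^T$, $w=[u_2,u_3]^T$. If $|\langle v,w\rangle|\ge\varsigma_Q\|v\|\|w\|$, take $(\theta_*,\phi_* )$ with $\theta_*\in[-\pi/4,\pi/4]$ and $r(\theta_*,\phi_* )=u$. Otherwise take $\phi_*$ with $[\cos\phi_*,\sin\phi_*]^T=v/\|v\|$ and $\theta_*\in[-\pi/4,\pi/4]$ maximizing $\theta\mapsto r(\theta,\phi_* )^T\Gamma\, r(\theta,\phi_* )$. $\Psi_k^*$ is the matrix with parameters $(\theta_*,\phi_* )$. *)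

theory Defs
  imports "HOL-Analysis.Analysis"
begin

text \<open>
  An \<open>m \<times> m\<close> complex matrix is an element of \<open>complex^'n^'n\<close> with \<open>m = CARD('n)\<close>; the linear order
  on \<open>'n\<close> gives a meaning to pairs \<open>i < j\<close>. The library norm on this type is the Frobenius norm.
\<close>

datatype star_kind = Transp | Herm

definition ctransp :: "complex^'n^'m \<Rightarrow> complex^'m^'n" where
  "ctransp A = (\<chi> p q. cnj (A $ q $ p))"

fun star :: "star_kind \<Rightarrow> complex^'n^'m \<Rightarrow> complex^'m^'n" where
  "star Transp A = transpose A"
| "star Herm A = ctransp A"

definition offdiag :: "complex^'n^'n \<Rightarrow> complex^'n^'n" where
  "offdiag W = (\<chi> p q. if p = q then 0 else W $ p $ q)"

definition W_mat :: "star_kind \<Rightarrow> complex^'n^'n \<Rightarrow> complex^'n^'n \<Rightarrow> complex^'n^'n" where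
  "W_mat S B X = star S X ** B ** X"

definition cost :: "star_kind \<Rightarrow> nat \<Rightarrow> (nat \<Rightarrow> complex^'n^'n) \<Rightarrow> complex^'n^'n \<Rightarrow> real" where
  "cost S L B X = (\<Sum>l = 1..L. (norm (offdiag (W_mat S (B l) X)))\<^sup>2)"

text \<open>
  The vector of partial derivatives. On \<open>complex^'n^'n\<close> the basis consists of the matrices with a
  single nonzero entry \<open>1\<close> or \<open>\<i>\<close>, so this is \<open>\<partial>g/\<partial>X\<^sup>R\<^sup>e + \<i> \<partial>g/\<partial>X\<^sup>I\<^sup>m\<close>.
\<close>
definition euclid_grad :: "('a::euclidean_space \<Rightarrow> real) \<Rightarrow> 'a \<Rightarrow> 'a" where
  "euclid_grad f x = (\<Sum>b\<in>Basis. deriv (\<lambda>t. f (x + t *\<^sub>R b)) 0 *\<^sub>R b)"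

text \<open>
  The gradient on the unit sphere at a point \<open>x\<close> of the sphere: the orthogonal projection of the
  Euclidean gradient onto the tangent space at \<open>x\<close>.
\<close>
definition sphere_grad :: "('a::euclidean_space \<Rightarrow> real) \<Rightarrow> 'a \<Rightarrow> 'a" where
  "sphere_grad f x = euclid_grad f x - (x \<bullet> euclid_grad f x) *\<^sub>R x"

definition Lam :: "(complex^'n^'n \<Rightarrow> real) \<Rightarrow> complex^'n^'n \<Rightarrow> complex^'n^'n" where
  "Lam g X = ctransp X ** euclid_grad g X
     - mat (trace (ctransp X ** euclid_grad g X) / of_nat CARD('n))"

text \<open>
  The Riemannian gradient on \<open>SL\<^sub>m(\<complex>)\<close> for the left-invariant metric
  \<open>Re tr ((X\<^sup>-\<^sup>1 V\<^sub>1)\<^sup>H X\<^sup>-\<^sup>1 V\<^sub>2)\<close>.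
\<close>
definition rgrad :: "(complex^'n^'n \<Rightarrow> real) \<Rightarrow> complex^'n^'n \<Rightarrow> complex^'n^'n" where
  "rgrad g X = X ** Lam g X"

definition SL :: "(complex^'n^'n) set" where
  "SL = {X. det X = 1}"

definition stationary_on_SL :: "(complex^'n^'n \<Rightarrow> real) \<Rightarrow> complex^'n^'n \<Rightarrow> bool" where
  "stationary_on_SL g X \<longleftrightarrow> X \<in> SL \<and> rgrad g X = 0"

definition elem_mat :: "'n \<Rightarrow> 'n \<Rightarrow> complex^2^2 \<Rightarrow> complex^'n^'n" where
  "elem_mat i j P = (\<chi> p q.
     if p = i \<and> q = i then P $ 1 $ 1
     else if p = i \<and> q = j then P $ 1 $ 2
     else if p = j \<and> q = i then P $ 2 $ 1
     else if p = j \<and> q = j then P $ 2 $ 2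
     else if p = q then 1 else 0)"

definition Psi_U :: "real \<times> real \<Rightarrow> complex^2^2" where
  "Psi_U = (\<lambda>(x, y). vector [vector [1, Complex x y], vector [0, 1]])"

definition Psi_L :: "real \<times> real \<Rightarrow> complex^2^2" where
  "Psi_L = (\<lambda>(x, y). vector [vector [1, 0], vector [Complex x y, 1]])"

definition Psi_D :: "real \<times> real \<Rightarrow> complex^2^2" where
  "Psi_D = (\<lambda>(x, y). vector [vector [Complex x y, 0], vector [0, 1 / Complex x y]])"

definition Psi_Q :: "real \<times> real \<times> real \<Rightarrow> complex^2^2" where
  "Psi_Q = (\<lambda>(c, s1, s2). vector [vector [of_real c, - Complex s1 s2],
                                   vector [Complex s1 (- s2), of_real c]])"

definition elem_fun ::
  "(complex^'n^'n \<Rightarrow> real) \<Rightarrow> complex^'n^'n \<Rightarrow> 'n \<Rightarrow> 'n \<Rightarrow> ('a \<Rightarrow> complex^2^2) \<Rightarrow> 'a \<Rightarrow> real" where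
  "elem_fun g X i j \<Psi> a = g (X ** elem_mat i j (\<Psi> a))"

datatype etype = TypeU | TypeL | TypeD | TypeQ

text \<open>The norm \<open>\<parallel>\<partial>h(I\<^sub>2)\<parallel>\<close>, for each type of elementary function \<open>h\<close>.\<close>
fun elem_grad_norm ::
  "(complex^'n^'n \<Rightarrow> real) \<Rightarrow> complex^'n^'n \<Rightarrow> 'n \<Rightarrow> 'n \<Rightarrow> etype \<Rightarrow> real" where
  "elem_grad_norm g X i j TypeU = norm (euclid_grad (elem_fun g X i j Psi_U) (0, 0))"
| "elem_grad_norm g X i j TypeL = norm (euclid_grad (elem_fun g X i j Psi_L) (0, 0))"
| "elem_grad_norm g X i j TypeD = norm (euclid_grad (elem_fun g X i j Psi_D) (1, 0))"
| "elem_grad_norm g X i j TypeQ = norm (sphere_grad (elem_fun g X i j Psi_Q) (1, 0, 0))"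

definition quad_minimizer :: "(real \<times> real \<Rightarrow> real) \<Rightarrow> real \<times> real \<Rightarrow> bool" where
  "quad_minimizer h p \<longleftrightarrow>
     (if \<forall>q r. h q = h r then p = (0, 0) else is_arg_min h (\<lambda>_. True) p)"

definition gam ::
  "star_kind \<Rightarrow> nat \<Rightarrow> (nat \<Rightarrow> complex^'n^'n) \<Rightarrow> complex^'n^'n \<Rightarrow> 'n \<Rightarrow> 'n \<Rightarrow> 'n \<Rightarrow> real" where
  "gam S L B X i j k = (\<Sum>l = 1..L. \<Sum>p\<in>UNIV - {i, j}.
     (cmod (W_mat S (B l) X $ k $ p))\<^sup>2 + (cmod (W_mat S (B l) X $ p $ k))\<^sup>2)"

text \<open>
  The ratio \<open>\<gamma>\<^sub>2 / \<gamma>\<^sub>1\<close> lives in \<open>[0, \<infinity>]\<close>; the case \<open>\<gamma>\<^sub>1 = 0 \<noteq> \<gamma>\<^sub>2\<close> is that of the value \<open>\<infinity>\<close>.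
\<close>
definition step_D :: "real \<Rightarrow> real \<Rightarrow> real \<Rightarrow> real" where
  "step_D \<sigma>\<^sub>D \<gamma>\<^sub>1 \<gamma>\<^sub>2 =
     (if \<gamma>\<^sub>1 = 0 \<and> \<gamma>\<^sub>2 = 0 then 1
      else if \<gamma>\<^sub>1 = 0 then 2
      else let w = \<gamma>\<^sub>2 / \<gamma>\<^sub>1 in
        if w < \<sigma>\<^sub>D then 1 / 2
        else if w > 1 / \<sigma>\<^sub>D then 2
        else w powr (1 / 4))"

fun rho :: "star_kind \<Rightarrow> real" where
  "rho Herm = 1"
| "rho Transp = - 1"

fun z_vec :: "star_kind \<Rightarrow> 'n \<Rightarrow> 'n \<Rightarrow> complex^'n^'n \<Rightarrow> complex^3" where
  "z_vec Herm i j W =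
     vector [W $ j $ j - W $ i $ i, W $ i $ j + W $ j $ i, - \<i> * (W $ i $ j - W $ j $ i)]"
| "z_vec Transp i j W =
     vector [W $ i $ j + W $ j $ i, W $ i $ i - W $ j $ j, \<i> * (W $ i $ i + W $ j $ j)]"

definition Gam ::
  "star_kind \<Rightarrow> nat \<Rightarrow> (nat \<Rightarrow> complex^'n^'n) \<Rightarrow> complex^'n^'n \<Rightarrow> 'n \<Rightarrow> 'n \<Rightarrow> real^3^3" where
  "Gam S L B X i j = (\<chi> a b. rho S / 2 *
     (\<Sum>l = 1..L. Re (z_vec S i j (W_mat S (B l) X) $ a * cnj (z_vec S i j (W_mat S (B l) X) $ b))))"

definition r_vec :: "real \<Rightarrow> real \<Rightarrow> real^3" where
  "r_vec \<theta> \<phi> = vector [cos (2 * \<theta>), - sin (2 * \<theta>) * cos \<phi>, - sin (2 * \<theta>) * sin \<phi>]"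

definition is_eigenvalue :: "real^'n^'n \<Rightarrow> real \<Rightarrow> bool" where
  "is_eigenvalue A \<mu> \<longleftrightarrow> (\<exists>x. x \<noteq> 0 \<and> A *v x = \<mu> *\<^sub>R x)"

definition top_unit_eigenvector :: "real^'n^'n \<Rightarrow> real^'n \<Rightarrow> bool" where
  "top_unit_eigenvector A u \<longleftrightarrow>
     norm u = 1 \<and> (\<exists>\<nu>. A *v u = \<nu> *\<^sub>R u \<and> (\<forall>\<mu>. is_eigenvalue A \<mu> \<longrightarrow> \<mu> \<le> \<nu>))"

text \<open>
  A relation rather than a function: neither the eigenvector nor the angles need be unique.
\<close>
definition step_Q :: "real \<Rightarrow> real^3^3 \<Rightarrow> real \<Rightarrow> real \<Rightarrow> bool" where
  "step_Q \<sigma>\<^sub>Q G \<theta> \<phi> \<longleftrightarrow>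
     (\<exists>u. top_unit_eigenvector G u \<and> u $ 1 \<ge> 0 \<and> \<theta> \<in> {- pi / 4..pi / 4} \<and>
        (let v = (G $ 1 $ 2, G $ 1 $ 3); w = (u $ 2, u $ 3) in
         if \<bar>v \<bullet> w\<bar> \<ge> \<sigma>\<^sub>Q * norm v * norm w
         then r_vec \<theta> \<phi> = u
         else (cos \<phi>, sin \<phi>) = v /\<^sub>R norm v \<and>
              is_arg_max (\<lambda>t. r_vec t \<phi> \<bullet> (G *v r_vec t \<phi>)) (\<lambda>t. t \<in> {- pi / 4..pi / 4}) \<theta>))"

text \<open>The possible values of \<open>\<Psi>\<^sub>k\<^sup>*\<close>, given the current iterate, the pair and the type.\<close>
fun elem_update ::
  "star_kind \<Rightarrow> nat \<Rightarrow> (nat \<Rightarrow> complex^'n^'n) \<Rightarrow> real \<Rightarrow> real \<Rightarrow> complex^'n^'n \<Rightarrow> 'n \<Rightarrow> 'n \<Rightarrow>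
   etype \<Rightarrow> complex^2^2 \<Rightarrow> bool" where
  "elem_update S L B \<sigma>\<^sub>D \<sigma>\<^sub>Q X i j TypeU P \<longleftrightarrow>
     (\<exists>p. quad_minimizer (elem_fun (cost S L B) X i j Psi_U) p \<and> P = Psi_U p)"
| "elem_update S L B \<sigma>\<^sub>D \<sigma>\<^sub>Q X i j TypeL P \<longleftrightarrow>
     (\<exists>p. quad_minimizer (elem_fun (cost S L B) X i j Psi_L) p \<and> P = Psi_L p)"
| "elem_update S L B \<sigma>\<^sub>D \<sigma>\<^sub>Q X i j TypeD P \<longleftrightarrow>
     P = Psi_D (step_D \<sigma>\<^sub>D (gam S L B X i j i) (gam S L B X i j j), 0)"
| "elem_update S L B \<sigma>\<^sub>D \<sigma>\<^sub>Q X i j TypeQ P \<longleftrightarrow>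
     (\<exists>\<theta> \<phi>. step_Q \<sigma>\<^sub>Q (Gam S L B X i j) \<theta> \<phi> \<and>
            P = Psi_Q (cos \<theta>, sin \<theta> * cos \<phi>, sin \<theta> * sin \<phi>))"

text \<open>Allows one to write a sort constraint on the index type, which \<open>complex^'n^'n\<close> does not.\<close>
type_synonym 'n cmat = "((complex, 'n) vec, 'n) vec"

definition jacobi_step ::
  "etype set \<Rightarrow> star_kind \<Rightarrow> nat \<Rightarrow> (nat \<Rightarrow> ('n::{finite,linorder}) cmat) \<Rightarrow> real \<Rightarrow> real \<Rightarrow> real \<Rightarrow>
   'n cmat \<Rightarrow> 'n cmat \<Rightarrow> bool" where
  "jacobi_step T S L B \<sigma>\<^sub>D \<sigma>\<^sub>Q \<epsilon> X X' \<longleftrightarrow>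
     (if rgrad (cost S L B) X = 0 then X' = X
      else \<exists>i j \<tau> P. i < j \<and> \<tau> \<in> T \<and>
             elem_grad_norm (cost S L B) X i j \<tau> \<ge> \<epsilon> * norm (Lam (cost S L B) X) \<and>
             elem_update S L B \<sigma>\<^sub>D \<sigma>\<^sub>Q X i j \<tau> P \<and>
             X' = X ** elem_mat i j P)"

definition jacobi_run ::
  "etype set \<Rightarrow> star_kind \<Rightarrow> nat \<Rightarrow> (nat \<Rightarrow> ('n::{finite,linorder}) cmat) \<Rightarrow> real \<Rightarrow> real \<Rightarrow> real \<Rightarrow>
   (nat \<Rightarrow> 'n cmat) \<Rightarrow> bool" where
  "jacobi_run T S L B \<sigma>\<^sub>D \<sigma>\<^sub>Q \<epsilon> X \<longleftrightarrow>
     X 0 \<in> SL \<and> (\<forall>k\<ge>1. jacobi_step T S L B \<sigma>\<^sub>D \<sigma>\<^sub>Q \<epsilon> (X (k - 1)) (X k))"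

definition jacobi_GLU ::
  "star_kind \<Rightarrow> nat \<Rightarrow> (nat \<Rightarrow> ('n::{finite,linorder}) cmat) \<Rightarrow> real \<Rightarrow> real \<Rightarrow> real \<Rightarrow>
   (nat \<Rightarrow> 'n cmat) \<Rightarrow> bool" where
  "jacobi_GLU S L B \<sigma>\<^sub>D \<sigma>\<^sub>Q \<epsilon> X \<longleftrightarrow>
     0 < \<epsilon> \<and> \<epsilon> < sqrt (2 / (3 * real CARD('n) * (real CARD('n) - 1))) \<and>
     jacobi_run {TypeU, TypeL, TypeD} S L B \<sigma>\<^sub>D \<sigma>\<^sub>Q \<epsilon> X"

definition jacobi_GQU ::
  "star_kind \<Rightarrow> nat \<Rightarrow> (nat \<Rightarrow> ('n::{finite,linorder}) cmat) \<Rightarrow> real \<Rightarrow> real \<Rightarrow> real \<Rightarrow>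
   (nat \<Rightarrow> 'n cmat) \<Rightarrow> bool" where
  "jacobi_GQU S L B \<sigma>\<^sub>D \<sigma>\<^sub>Q \<epsilon> X \<longleftrightarrow>
     0 < \<epsilon> \<and> \<epsilon> < sqrt ((3 - sqrt 5) / (3 * real CARD('n) * (real CARD('n) - 1))) \<and>
     jacobi_run {TypeQ, TypeU, TypeD} S L B \<sigma>\<^sub>D \<sigma>\<^sub>Q \<epsilon> X"

text \<open>
  Accumulation points are meant in the sense of sequences, i.e. as limits of subsequences. (A limit
  point of the range would exclude an eventually constant run.)
\<close>
definition accumulation_point :: "(nat \<Rightarrow> 'a::topological_space) \<Rightarrow> 'a \<Rightarrow> bool" where
  "accumulation_point X a \<longleftrightarrow> (\<exists>r. strict_mono r \<and> (X \<circ> r) \<longlonglongrightarrow> a)"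

end

theory Submission
  imports Defs
begin

text \<open>
  Every elementary step decreases the cost by at least a constant times \<open>\<parallel>\<partial>h(I\<^sub>2)\<parallel>\<^sup>2\<close>, where the constant
  depends only on an upper bound for \<open>\<Sum>\<^sub>l \<parallel>W\<^sub>l\<parallel>\<^sup>2\<close>, hence only on the bound for the iterates: in types
  \<open>U\<close> and \<open>L\<close> the function \<open>h\<close> is a quadratic polynomial with bounded leading part; in type \<open>D\<close> it is
  \<open>c + \<gamma>\<^sub>1 |z|\<^sup>2 + \<gamma>\<^sub>2 / |z|\<^sup>2\<close>; in type \<open>Q\<close> the step is compared with a small rotation in the direction of
  the gradient. Together with \<open>\<parallel>\<partial>h(I\<^sub>2)\<parallel> \<ge> \<epsilon> \<parallel>\<Lambda>\<parallel>\<close>, the convergence of the nonincreasing costs forces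
  \<open>\<Lambda>(X\<^sub>k) \<longlonglongrightarrow> 0\<close>, and \<open>\<Lambda>\<close> is continuous.
\<close>

subsection \<open>The cost function and its gradient\<close>

text \<open>The overview names the model in each type; the obstacles are these. In types
  \<open>U\<close> and \<open>L\<close> the only second-order term of the congruence lands on the
  diagonal entry (j,j), which \<open>offdiag\<close> erases, so inside each norm the dependence on
  the parameter is affine. In type \<open>D\<close> a clipped step (1/2 or 2) need not be a
  minimizer; it still gains because \<open>\<sigma>\<^sub>D\<close> < 1/4, and this margin is the
  factor \<open>1 - 4 * \<sigma>\<^sub>D\<close> of the final constant. In type \<open>Q\<close> the
  eigenvector and the angles need not be unique or depend continuously on the iterate. This does no
  harm, since only values are compared: an eigenvector step maximizes the form over the whole
  sphere, the other one over an arc of the meridian in the gradient direction, and that arc contains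
  one explicit small-angle point with a quantitative gain. The transpose and the conjugate transpose
  are treated together through an entrywise map, and part ways only in the 2 by 2 computation for
  type \<open>Q\<close>.\<close>

fun star_cnj :: "star_kind \<Rightarrow> complex \<Rightarrow> complex" where
  "star_cnj Transp z = z"
| "star_cnj Herm z = cnj z"

text \<open>Both kinds of S become an index swap followed by a map of the entries that is additive,
  multiplicative, real-linear and modulus-preserving, which spares most later proofs a case
  distinction.\<close>

lemma star_nth [simp]: "star S A $ p $ q = star_cnj S (A $ q $ p)"
  by (cases S) (simp_all add: transpose_def ctransp_def)

lemma cmod_star_cnj [simp]: "cmod (star_cnj S z) = cmod z"
  by (cases S) simp_all

lemma star_cnj_simps [simp]:
  "star_cnj S 0 = 0" "star_cnj S 1 = 1"
  "star_cnj S (z + w) = star_cnj S z + star_cnj S w"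
  "star_cnj S (z * w) = star_cnj S z * star_cnj S w"
  "star_cnj S (r *\<^sub>R z) = r *\<^sub>R star_cnj S z"
  by (cases S; simp)+

lemma star_cnj_sum: "star_cnj S (sum f A) = (\<Sum>x\<in>A. star_cnj S (f x))"
  by (cases S) simp_all

lemma star_matrix_mult: "star S (A ** B) = star S B ** star S A"
  by (simp add: vec_eq_iff matrix_matrix_mult_def star_cnj_sum mult.commute)

lemma W_mat_mult: "W_mat S B (X ** E) = star S E ** W_mat S B X ** E"
  by (simp add: W_mat_def star_matrix_mult matrix_mul_assoc)

lemma cost_mult:
  "cost S L B (X ** E) = (\<Sum>l = 1..L. (norm (offdiag (star S E ** W_mat S (B l) X ** E)))\<^sup>2)"
  by (simp add: cost_def W_mat_mult)

lemma norm_matrix_power2: "(norm (A :: complex^'n^'m))\<^sup>2 = (\<Sum>p\<in>UNIV. \<Sum>q\<in>UNIV. (cmod (A $ p $ q))\<^sup>2)"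
  by (simp add: norm_vec_def L2_set_def sum_nonneg)

lemma matrix_mult_add_left: "(A + B) ** C = A ** C + B ** (C :: complex^'n^'m)"
  by (simp add: matrix_matrix_mult_def vec_eq_iff distrib_right sum.distrib)

lemma matrix_mult_scaleR_left: "(c *\<^sub>R A) ** B = c *\<^sub>R (A ** (B :: complex^'n^'m))"
  by (simp add: matrix_matrix_mult_def vec_eq_iff scaleR_sum_right)

lemma matrix_mult_scaleR_right: "A ** (c *\<^sub>R B) = c *\<^sub>R (A ** (B :: complex^'n^'m))"
  by (simp add: matrix_matrix_mult_def vec_eq_iff scaleR_sum_right)

lemma bounded_bilinear_matrix_mult:
  "bounded_bilinear ((**) :: complex^'n^'m \<Rightarrow> complex^'k^'n \<Rightarrow> complex^'k^'m)"
  unfolding bilinear_conv_bounded_bilinear [symmetric] bilinear_def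
  by (auto intro!: linearI simp: matrix_add_ldistrib matrix_mult_add_left matrix_mult_scaleR_left
      matrix_mult_scaleR_right)

lemma bounded_linear_star: "bounded_linear (star S)"
  unfolding linear_conv_bounded_linear [symmetric]
  by (rule linearI) (simp_all add: vec_eq_iff)

lemma bounded_linear_offdiag: "bounded_linear offdiag"
  unfolding linear_conv_bounded_linear [symmetric]
  by (rule linearI) (simp_all add: vec_eq_iff offdiag_def)

lemma norm_offdiag_le: "norm (offdiag A) \<le> norm A"
  by (rule norm_le_componentwise_cart) 
     (simp add: norm_le_componentwise_cart offdiag_def)

text \<open>The real Frechet derivative at X in direction Y. The inner product is the real one on
  complex matrices, and \<open>star S\<close> is real-linear for both S, so the product rule gives
  the two summands.\<close>

definition cost_deriv ::
  "star_kind \<Rightarrow> nat \<Rightarrow> (nat \<Rightarrow> complex^'n^'n) \<Rightarrow> complex^'n^'n \<Rightarrow> complex^'n^'n \<Rightarrow> real" where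
  "cost_deriv S L B X Y = (\<Sum>l = 1..L. 2 * (offdiag (W_mat S (B l) X) \<bullet>
     offdiag (star S X ** B l ** Y + star S Y ** B l ** X)))"

lemmas matrix_derivative_rules =
  bounded_linear.has_derivative [OF bounded_linear_star]
  bounded_linear.has_derivative [OF bounded_linear_offdiag]
  bounded_bilinear.FDERIV [OF bounded_bilinear_matrix_mult]

lemmas matrix_continuous_rules =
  bounded_linear.continuous_on [OF bounded_linear_star]
  bounded_linear.continuous_on [OF bounded_linear_offdiag]
  bounded_bilinear.continuous_on [OF bounded_bilinear_matrix_mult]

lemma has_derivative_cost: "(cost S L B has_derivative cost_deriv S L B X) (at X)"
proof -
  have "((\<lambda>X. \<Sum>l = 1..L. offdiag (star S X ** B l ** X) \<bullet> offdiag (star S X ** B l ** X))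
      has_derivative cost_deriv S L B X) (at X)"
    unfolding cost_deriv_def W_mat_def
    apply (rule has_derivative_eq_rhs)
     apply (rule derivative_intros matrix_derivative_rules)+
    by (rule ext) (simp add: inner_commute bounded_bilinear.zero_right[OF bounded_bilinear_matrix_mult])
  then show ?thesis
    by (simp add: cost_def [abs_def] W_mat_def power2_norm_eq_inner)
qed

text \<open>\<open>euclid_grad\<close> is built from partial derivatives via \<open>deriv\<close>;
  this trades them for a Frechet derivative, to which the calculus rules apply.\<close>

lemma euclid_grad_has_derivative:
  assumes "(f has_derivative D) (at x)"
  shows "euclid_grad f x = (\<Sum>b\<in>Basis. D b *\<^sub>R b)"
proof -
  have "deriv (\<lambda>t. f (x + t *\<^sub>R b)) 0 = D b" for b
  proof (rule DERIV_imp_deriv)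
    have f: "(f has_derivative D) (at (x + 0 *\<^sub>R b))"
      using assms by simp
    have "((\<lambda>t. f (x + t *\<^sub>R b)) has_derivative (\<lambda>t. D (t *\<^sub>R b))) (at 0)"
      by (rule has_derivative_compose [where f = "\<lambda>t. x + t *\<^sub>R b" and g = f, OF _ f])
         (auto intro!: derivative_eq_intros)
    moreover have "D (t *\<^sub>R b) = t * D b" for t
      using linear_cmul [OF has_derivative_linear [OF assms]] by simp
    ultimately show "((\<lambda>t. f (x + t *\<^sub>R b)) has_field_derivative D b) (at 0)"
      by (simp add: has_field_derivative_def mult_commute_abs)
  qed
  then show ?thesis
    by (simp add: euclid_grad_def)
qed

lemma euclid_grad_inner:
  assumes "(f has_derivative D) (at x)"
  shows "euclid_grad f x \<bullet> y = D y"
proof -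
  interpret D: linear D
    using assms by (rule has_derivative_linear)
  have "D y = D (\<Sum>b\<in>Basis. (y \<bullet> b) *\<^sub>R b)"
    by (simp add: euclidean_representation)
  then show ?thesis
    by (simp add: euclid_grad_has_derivative [OF assms] D.sum D.scale inner_sum_right mult.commute
        inner_commute [of _ y])
qed

lemma continuous_on_euclid_grad_cost: "continuous_on UNIV (euclid_grad (cost S L B))"
  unfolding euclid_grad_has_derivative [OF has_derivative_cost, abs_def] cost_deriv_def W_mat_def
  by (intro continuous_intros matrix_continuous_rules)

lemma continuous_on_Lam_cost: "continuous_on UNIV (Lam (cost S L B))"
proof -
  have *: "continuous_on UNIV (\<lambda>X. ctransp X ** euclid_grad (cost S L B) X)"
    using continuous_on_euclid_grad_cost
      bounded_linear.continuous_on [OF bounded_linear_star continuous_on_id, of UNIV Herm]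
    by (auto intro!: bounded_bilinear.continuous_on [OF bounded_bilinear_matrix_mult])
  then show ?thesis
    unfolding Lam_def [abs_def] mat_def trace_def
    apply (intro continuous_on_diff * continuous_on_vec_lambda)
    subgoal for p q
      by (cases "p = q") (auto intro!: continuous_intros simp: continuous_on_component)
    done
qed

lemma continuous_on_W_mat: "continuous_on UNIV (W_mat S B)"
  unfolding W_mat_def [abs_def]
  by (intro continuous_intros matrix_continuous_rules)

text \<open>In the Leibniz expansion a row k outside {i, j} has its only nonzero entry on the
  diagonal, so a contributing permutation fixes k. Only the identity and the transposition of i and
  j survive, and they give the 2 by 2 determinant.\<close>

lemma det_elem_mat:
  fixes i j :: "'n::finite"
  assumes "i \<noteq> j"
  shows "det (elem_mat i j P) = det P"
proof -
  let ?E = "elem_mat i j P"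
  let ?f = "\<lambda>p. of_int (sign p) * (\<Prod>k\<in>UNIV. ?E $ k $ p k)"
  have zero: "?f p = 0" if p: "p permutes UNIV" and "p \<noteq> id" "p \<noteq> Transposition.transpose i j" for p
  proof (rule ccontr)
    assume nz: "?f p \<noteq> 0"
    then have nz: "?E $ k $ p k \<noteq> 0" for k
      by auto
    have fixed: "p k = k" if "k \<noteq> i" "k \<noteq> j" for k
    proof (rule ccontr)
      assume "p k \<noteq> k"
      then have "?E $ k $ p k = 0"
        using that by (simp add: elem_mat_def)
      then show False
        using nz by blast
    qed
    have "inj p"
      using p by (rule permutes_inj)
    then have "p i \<noteq> p k" "p j \<noteq> p k" if "k \<noteq> i" "k \<noteq> j" for k
      using that by (simp_all add: inj_eq)
    then have "p i = i \<or> p i = j" "p j = i \<or> p j = j"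
      using fixed by metis+
    moreover have "p i \<noteq> p j"
      using \<open>inj p\<close> assms by (simp add: inj_eq)
    ultimately consider "p i = i" "p j = j" | "p i = j" "p j = i"
      by auto
    then have "p = id \<or> p = Transposition.transpose i j"
    proof cases
      case 1
      then have "p = id"
        using fixed by (metis ext id_apply)
      then show ?thesis ..
    next
      case 2
      then have "p = Transposition.transpose i j"
        using fixed by (metis ext transpose_apply_first transpose_apply_second transpose_apply_other)
      then show ?thesis ..
    qed
    then show False
      using \<open>p \<noteq> id\<close> \<open>p \<noteq> Transposition.transpose i j\<close> by blast
  qed
  have split: "(\<Prod>k\<in>UNIV. h k) = h i * h j * (\<Prod>k\<in>UNIV - {i, j}. h k)" for h :: "'n \<Rightarrow> complex"
  proof -
    have "(\<Prod>k\<in>UNIV. h k) = (\<Prod>k\<in>insert i (insert j (UNIV - {i, j})). h k)"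
      by (rule prod.cong) auto
    then show ?thesis
      using assms by (simp add: mult.assoc)
  qed
  have rest: "(\<Prod>k\<in>UNIV - {i, j}. ?E $ k $ k) = 1"
    "(\<Prod>k\<in>UNIV - {i, j}. ?E $ k $ Transposition.transpose i j k) = 1"
    by (auto intro!: prod.neutral simp: elem_mat_def Transposition.transpose_def)
  have ne: "id \<noteq> Transposition.transpose i j"
    using assms by (metis id_apply transpose_apply_first)
  have "det ?E = (\<Sum>p\<in>{id, Transposition.transpose i j}. ?f p)"
    unfolding det_def
  proof (rule sum.mono_neutral_right)
    show "{id, Transposition.transpose i j} \<subseteq> {p. p permutes UNIV}"
      by (simp add: permutes_id permutes_swap_id)
    show "\<forall>p\<in>{p. p permutes UNIV} - {id, Transposition.transpose i j}. ?f p = 0"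
      using zero by blast
  qed simp
  also have "\<dots> = ?E $ i $ i * ?E $ j $ j - ?E $ i $ j * ?E $ j $ i"
    using assms ne rest by (simp add: split sign_id sign_swap_id)
  also have "\<dots> = det P"
    using assms by (simp add: elem_mat_def det_2)
  finally show ?thesis .
qed

subsection \<open>Shear steps\<close>

text \<open>A lower shear is an upper shear for the swapped pair, so type \<open>L\<close> inherits
  everything proved for type \<open>U\<close>; this is why those lemmas assume i \<noteq> j rather
  than i < j.\<close>

lemma elem_mat_Psi_L: "i \<noteq> j \<Longrightarrow> elem_mat i j (Psi_L p) = elem_mat j i (Psi_U p)"
  by (cases p) (auto simp: vec_eq_iff elem_mat_def Psi_L_def Psi_U_def)

lemma elem_mat_Psi_U_nth:
  "i \<noteq> j \<Longrightarrow> elem_mat i j (Psi_U (x, y)) $ p $ q =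
     (if p = q then 1 else 0) + (if p = i \<and> q = j then Complex x y else 0)"
  by (auto simp: elem_mat_def Psi_U_def)

text \<open>The first-order change of the off-diagonal part under a shear with parameter z = x + iy:
  column j receives z times column i, and row j the conjugated or plain multiple of row i.\<close>

definition shear :: "star_kind \<Rightarrow> 'n \<Rightarrow> 'n \<Rightarrow> complex^'n^'n \<Rightarrow> real \<times> real \<Rightarrow> complex^'n^'n" where
  "shear S i j W = (\<lambda>(x, y). offdiag (\<chi> p q.
     (if q = j then Complex x y * W $ p $ i else 0) +
     (if p = j then star_cnj S (Complex x y) * W $ i $ q else 0)))"

text \<open>The product of the row operation and the column operation is the term with factor W_ii
  at position (j,j), the only one of second order in z. It lies on the diagonal, hence the identity
  is exact and affine.\<close>

lemma offdiag_conj_Psi_U: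
  fixes W :: "complex^'n::finite^'n"
  assumes "i \<noteq> j"
  shows "offdiag (star S (elem_mat i j (Psi_U a)) ** W ** elem_mat i j (Psi_U a)) =
    offdiag W + shear S i j W a"
proof -
  obtain x y where a: "a = (x, y)"
    by fastforce
  let ?z = "Complex x y"
  let ?E = "elem_mat i j (Psi_U a)"
  have 1: "(star S ?E ** W) $ p $ q = W $ p $ q + (if p = j then star_cnj S ?z * W $ i $ q else 0)" for p q
  proof -
    have "(star S ?E ** W) $ p $ q =
      (\<Sum>k\<in>UNIV. (if k = p then W $ p $ q else 0) +
         (if k = i then if p = j then star_cnj S ?z * W $ i $ q else 0 else 0))"
      unfolding matrix_matrix_mult_def a vec_lambda_beta
      by (rule sum.cong) (auto simp: elem_mat_Psi_U_nth [OF assms] algebra_simps)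
    then show ?thesis
      by (simp add: sum.distrib)
  qed
  have 2: "(V ** ?E) $ p $ q = V $ p $ q + (if q = j then ?z * V $ p $ i else 0)"
    for V :: "complex^'n^'n" and p q
  proof -
    have "(V ** ?E) $ p $ q =
      (\<Sum>k\<in>UNIV. (if k = q then V $ p $ q else 0) +
         (if k = i then if q = j then ?z * V $ p $ i else 0 else 0))"
      unfolding matrix_matrix_mult_def a vec_lambda_beta
      by (rule sum.cong) (auto simp: elem_mat_Psi_U_nth [OF assms] algebra_simps)
    then show ?thesis
      by (simp add: sum.distrib)
  qed
  show ?thesis
    using assms by (simp add: vec_eq_iff offdiag_def shear_def a 1 [unfolded a] 2 [unfolded a] algebra_simps)
qed

lemma linear_shear: "linear (shear S i j W)"
proof -
  have add: "Complex (x + x') (y + y') = Complex x y + Complex x' y'"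
    and scale: "Complex (r *\<^sub>R x) (r *\<^sub>R y) = r *\<^sub>R Complex x y" for x y x' y' r
    by (simp_all add: complex_eq_iff)
  have "shear S i j W (a + b) $ p $ q = shear S i j W a $ p $ q + shear S i j W b $ p $ q"
    "shear S i j W (r *\<^sub>R a) $ p $ q = r *\<^sub>R shear S i j W a $ p $ q" for a b r p q
    by (auto simp only: shear_def offdiag_def add scale star_cnj_simps distrib_right vec_lambda_beta
        plus_prod_def scaleR_prod_def fst_conv snd_conv case_prod_unfold mult_scaleR_left
        scaleR_add_right scaleR_zero_right add_0_left add_0_right split: if_splits)
  then show ?thesis
    by (intro linearI) (simp_all add: vec_eq_iff)
qed

text \<open>Before the diagonal is removed, the shear is a sum of one matrix supported in column j
  and one in row j, each carrying a line of W scaled by the modulus of the parameter.\<close>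

lemma norm_shear_le:
  fixes W :: "complex^'n::finite^'n"
  shows "norm (shear S i j W a) \<le> 2 * norm a * norm W"
proof -
  obtain x y where a: "a = (x, y)"
    by fastforce
  let ?z = "Complex x y"
  let ?P = "(\<chi> p q. if q = j then ?z * W $ p $ i else 0) :: complex^'n^'n"
  let ?Q = "(\<chi> p q. if p = j then star_cnj S ?z * W $ i $ q else 0) :: complex^'n^'n"
  have z: "cmod ?z = norm a"
    by (simp add: a cmod_def norm_prod_def)
  have "norm ?P \<le> norm a * norm W"
  proof (rule power2_le_imp_le)
    have "(norm ?P)\<^sup>2 = (\<Sum>p\<in>UNIV. (norm a)\<^sup>2 * (cmod (W $ p $ i))\<^sup>2)"
      by (simp add: norm_matrix_power2 if_distrib [of "\<lambda>x. (cmod x)\<^sup>2"] norm_mult z power_mult_distrib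
          cong: if_cong)
    also have "\<dots> \<le> (\<Sum>p\<in>UNIV. (norm a)\<^sup>2 * (\<Sum>q\<in>UNIV. (cmod (W $ p $ q))\<^sup>2))"
      by (intro sum_mono mult_left_mono member_le_sum) auto
    also have "\<dots> = (norm a * norm W)\<^sup>2"
      by (simp add: power_mult_distrib norm_matrix_power2 sum_distrib_left)
    finally show "(norm ?P)\<^sup>2 \<le> (norm a * norm W)\<^sup>2" .
  qed simp
  moreover have "norm ?Q \<le> norm a * norm W"
  proof (rule power2_le_imp_le)
    have "(norm ?Q)\<^sup>2 = (norm a)\<^sup>2 * (\<Sum>q\<in>UNIV. (cmod (W $ i $ q))\<^sup>2)"
      by (subst norm_matrix_power2, subst sum.swap)
        (simp add: if_distrib [of "\<lambda>x. (cmod x)\<^sup>2"] norm_mult z power_mult_distrib sum_distrib_left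
          cong: if_cong)
    also have "\<dots> \<le> (norm a)\<^sup>2 * (\<Sum>p\<in>UNIV. \<Sum>q\<in>UNIV. (cmod (W $ p $ q))\<^sup>2)"
      by (intro mult_left_mono member_le_sum [of i UNIV "\<lambda>p. \<Sum>q\<in>UNIV. (cmod (W $ p $ q))\<^sup>2"] sum_nonneg) auto
    also have "\<dots> = (norm a * norm W)\<^sup>2"
      by (simp add: power_mult_distrib norm_matrix_power2)
    finally show "(norm ?Q)\<^sup>2 \<le> (norm a * norm W)\<^sup>2" .
  qed simp
  moreover have "shear S i j W a = offdiag (?P + ?Q)"
    by (simp add: shear_def a vec_eq_iff offdiag_def)
  moreover have "norm (offdiag (?P + ?Q)) \<le> norm ?P + norm ?Q"
    using norm_offdiag_le norm_triangle_ineq by (rule order_trans)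
  ultimately show ?thesis
    by simp
qed

text \<open>A global minimizer does at least as well as one gradient step, and f a is at most f 0 +
  \<beta> \<bullet> a + A (norm a)^2 with \<beta> the gradient at 0.\<close>

lemma quadratic_sufficient_decrease:
  fixes T :: "'l \<Rightarrow> 'a::euclidean_space \<Rightarrow> 'b::real_inner"
  assumes f: "\<And>a. f a = (\<Sum>l\<in>I. (norm (c l + T l a))\<^sup>2)"
    and T: "\<And>l. l \<in> I \<Longrightarrow> linear (T l)"
    and le: "\<And>a. (\<Sum>l\<in>I. (norm (T l a))\<^sup>2) \<le> A * (norm a)\<^sup>2"
    and "A > 0" and min: "\<And>a. f p \<le> f a"
  shows "(norm (euclid_grad f 0))\<^sup>2 / (4 * A) \<le> f 0 - f p"
proof -
  let ?D = "\<lambda>a. \<Sum>l\<in>I. 2 * (c l \<bullet> T l a)"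
  let ?\<beta> = "euclid_grad f 0"
  \<comment> \<open>The minimizer of s + A s^2, which is the upper bound along the gradient up to
    the factor (norm \<beta>)^2; its value is -1/(4A).\<close>
  let ?s = "- 1 / (2 * A)"
  have f': "f a = f 0 + ?D a + (\<Sum>l\<in>I. (norm (T l a))\<^sup>2)" for a
    unfolding f
    by (simp add: power2_norm_eq_inner algebra_simps sum.distrib linear_0 [OF T] inner_commute
       sum_distrib_left)
  have blT: "bounded_linear (T l)" if "l \<in> I" for l
    using T [OF that] by (simp add: linear_conv_bounded_linear)
  have "((\<lambda>a. f 0 + ?D a + (\<Sum>l\<in>I. T l a \<bullet> T l a)) has_derivative ?D) (at 0)"
    apply (rule has_derivative_eq_rhs)
     apply (rule derivative_intros bounded_linear.has_derivative [OF blT] | assumption)+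
    by (simp add: linear_0 [OF T])
  then have "(f has_derivative ?D) (at 0)"
    by (subst f' [abs_def]) (simp add: power2_norm_eq_inner)
  note \<beta> = euclid_grad_inner [OF this]
  have "?D (?s *\<^sub>R ?\<beta>) = ?s * (norm ?\<beta>)\<^sup>2"
    by (simp add: \<beta> [symmetric] power2_norm_eq_inner)
  moreover have "(\<Sum>l\<in>I. (norm (T l (?s *\<^sub>R ?\<beta>)))\<^sup>2) \<le> A * (?s\<^sup>2 * (norm ?\<beta>)\<^sup>2)"
    using le [of "?s *\<^sub>R ?\<beta>"] by (simp add: power_mult_distrib power_divide)
  ultimately have "f (?s *\<^sub>R ?\<beta>) \<le> f 0 + ?s * (norm ?\<beta>)\<^sup>2 + A * (?s\<^sup>2 * (norm ?\<beta>)\<^sup>2)"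
    using f' [of "?s *\<^sub>R ?\<beta>"] by linarith
  also have "\<dots> = f 0 - (norm ?\<beta>)\<^sup>2 / (4 * A)"
    using \<open>A > 0\<close> by (simp add: field_simps power2_eq_square)
  finally show ?thesis
    using min [of "?s *\<^sub>R ?\<beta>"] by linarith
qed

text \<open>When h is constant, the default (0, 0) is a minimizer as well, so both branches of the
  definition give a global minimizer.\<close>

lemma quad_minimizer_le: "quad_minimizer h p \<Longrightarrow> h p \<le> h q"
  unfolding quad_minimizer_def is_arg_min_linorder by (metis order_refl)

text \<open>The shear bound, squared and summed, gives A = 4C in the quadratic estimate, whence the
  constant 16C.\<close>

lemma sufficient_decrease_U:
  fixes X :: "complex^'n::finite^'n"
  assumes "i \<noteq> j" and C: "(\<Sum>l = 1..L. (norm (W_mat S (B l) X))\<^sup>2) \<le> C" "C > 0"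
    and min: "quad_minimizer (elem_fun (cost S L B) X i j Psi_U) p"
  shows "(norm (euclid_grad (elem_fun (cost S L B) X i j Psi_U) (0, 0)))\<^sup>2 / (16 * C)
    \<le> cost S L B X - cost S L B (X ** elem_mat i j (Psi_U p))"
proof -
  let ?h = "elem_fun (cost S L B) X i j Psi_U"
  let ?W = "\<lambda>l. W_mat S (B l) X"
  have h: "?h a = (\<Sum>l = 1..L. (norm (offdiag (?W l) + shear S i j (?W l) a))\<^sup>2)" for a
    by (simp add: elem_fun_def cost_mult offdiag_conj_Psi_U [OF \<open>i \<noteq> j\<close>])
  have "(\<Sum>l = 1..L. (norm (shear S i j (?W l) a))\<^sup>2) \<le> 4 * C * (norm a)\<^sup>2" for a
  proof -
    have "(norm (shear S i j (?W l) a))\<^sup>2 \<le> (2 * norm a * norm (?W l))\<^sup>2" for l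
      by (rule power_mono [OF norm_shear_le]) simp
    then have "(\<Sum>l = 1..L. (norm (shear S i j (?W l) a))\<^sup>2) \<le>
        (\<Sum>l = 1..L. 4 * (norm a)\<^sup>2 * (norm (?W l))\<^sup>2)"
      by (intro sum_mono) (simp add: power_mult_distrib)
    also have "\<dots> \<le> 4 * (norm a)\<^sup>2 * C"
      unfolding sum_distrib_left [symmetric] by (intro mult_left_mono C) simp
    finally show ?thesis
      by (simp add: mult.commute mult.left_commute)
  qed
  from quadratic_sufficient_decrease [of ?h, OF h linear_shear this _ quad_minimizer_le [OF min]] C(2)
  have "(norm (euclid_grad ?h 0))\<^sup>2 / (4 * (4 * C)) \<le> ?h 0 - ?h p"
    by simp
  moreover have "?h 0 = cost S L B X"
    by (simp add: h linear_0 [OF linear_shear] cost_def)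
  ultimately show ?thesis
    by (simp add: elem_fun_def zero_prod_def)
qed

lemma sufficient_decrease_L:
  fixes X :: "complex^'n::finite^'n"
  assumes "i \<noteq> j" and C: "(\<Sum>l = 1..L. (norm (W_mat S (B l) X))\<^sup>2) \<le> C" "C > 0"
    and min: "quad_minimizer (elem_fun (cost S L B) X i j Psi_L) p"
  shows "(norm (euclid_grad (elem_fun (cost S L B) X i j Psi_L) (0, 0)))\<^sup>2 / (16 * C)
    \<le> cost S L B X - cost S L B (X ** elem_mat i j (Psi_L p))"
proof -
  have "elem_fun (cost S L B) X i j Psi_L = elem_fun (cost S L B) X j i Psi_U"
    by (simp add: fun_eq_iff elem_fun_def elem_mat_Psi_L [OF \<open>i \<noteq> j\<close>])
  then show ?thesis
    using sufficient_decrease_U [of j i S B X L C p] assms by (simp add: elem_mat_Psi_L)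
qed

subsection \<open>Diagonal steps\<close>

lemma sum_split_pair:
  fixes h :: "'n::finite \<Rightarrow> 'a::comm_monoid_add"
  assumes "i \<noteq> j"
  shows "sum h UNIV = h i + h j + sum h (UNIV - {i, j})"
proof -
  have "sum h UNIV = sum h (insert i (insert j (UNIV - {i, j})))"
    by (rule sum.cong) auto
  then show ?thesis
    using assms by (simp add: add.assoc)
qed

text \<open>The entries are grouped by how many of their indices lie in {i, j}: the 2 by 2 block,
  the cross entries that \<open>gam\<close> adds up for i and for j, and the entries that no
  elementary congruence for this pair changes.\<close>

lemma norm_matrix_power2_split:
  fixes A :: "complex^'n::finite^'n"
  assumes "i \<noteq> j"
  shows "(norm A)\<^sup>2 = (cmod (A$i$i))\<^sup>2 + (cmod (A$i$j))\<^sup>2 + (cmod (A$j$i))\<^sup>2 + (cmod (A$j$j))\<^sup>2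
    + (\<Sum>p\<in>UNIV - {i, j}. (cmod (A$i$p))\<^sup>2 + (cmod (A$p$i))\<^sup>2)
    + (\<Sum>p\<in>UNIV - {i, j}. (cmod (A$j$p))\<^sup>2 + (cmod (A$p$j))\<^sup>2)
    + (\<Sum>p\<in>UNIV - {i, j}. \<Sum>q\<in>UNIV - {i, j}. (cmod (A$p$q))\<^sup>2)"
  by (simp add: norm_matrix_power2 sum_split_pair [OF assms] sum.distrib algebra_simps)

lemma matrix_mult_elem_mat:
  fixes V :: "complex^'n::finite^'m"
  assumes "i \<noteq> j"
  shows "(V ** elem_mat i j P) $ p $ i = V $ p $ i * P $ 1 $ 1 + V $ p $ j * P $ 2 $ 1"
    and "(V ** elem_mat i j P) $ p $ j = V $ p $ i * P $ 1 $ 2 + V $ p $ j * P $ 2 $ 2"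
    and "q \<notin> {i, j} \<Longrightarrow> (V ** elem_mat i j P) $ p $ q = V $ p $ q"
proof -
  have rest: "(\<Sum>k\<in>UNIV - {i, j}. V $ p $ k * elem_mat i j P $ k $ q) = (if q \<in> {i, j} then 0 else V $ p $ q)"
    for q
  proof -
    have "(\<Sum>k\<in>UNIV - {i, j}. V $ p $ k * elem_mat i j P $ k $ q) =
      (\<Sum>k\<in>UNIV - {i, j}. if k = q then V $ p $ q else 0)"
      by (rule sum.cong) (auto simp: elem_mat_def)
    then show ?thesis
      by simp
  qed
  show "(V ** elem_mat i j P) $ p $ i = V $ p $ i * P $ 1 $ 1 + V $ p $ j * P $ 2 $ 1"
    and "(V ** elem_mat i j P) $ p $ j = V $ p $ i * P $ 1 $ 2 + V $ p $ j * P $ 2 $ 2"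
    and "q \<notin> {i, j} \<Longrightarrow> (V ** elem_mat i j P) $ p $ q = V $ p $ q"
    using assms by (simp_all add: matrix_matrix_mult_def sum_split_pair [OF assms] rest)
      (auto simp: elem_mat_def)
qed

lemma star_star [simp]: "star S (star S A) = A"
  by (cases S) (simp_all add: vec_eq_iff transpose_def ctransp_def)

text \<open>Left multiplication is obtained from right multiplication by applying the involution
  \<open>star S\<close> to the product.\<close>

lemma star_elem_mat_mult:
  fixes V :: "complex^'m^'n::finite"
  assumes "i \<noteq> j"
  shows "(star S (elem_mat i j P) ** V) $ i $ q =
      star_cnj S (P $ 1 $ 1) * V $ i $ q + star_cnj S (P $ 2 $ 1) * V $ j $ q"
    and "(star S (elem_mat i j P) ** V) $ j $ q =
      star_cnj S (P $ 1 $ 2) * V $ i $ q + star_cnj S (P $ 2 $ 2) * V $ j $ q"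
    and "p \<notin> {i, j} \<Longrightarrow> (star S (elem_mat i j P) ** V) $ p $ q = V $ p $ q"
proof -
  have "star S (elem_mat i j P) ** V = star S (star S V ** elem_mat i j P)"
    by (simp add: star_matrix_mult)
  moreover have "star_cnj S (star_cnj S z) = z" for z
    by (cases S) simp_all
  ultimately show "(star S (elem_mat i j P) ** V) $ i $ q =
      star_cnj S (P $ 1 $ 1) * V $ i $ q + star_cnj S (P $ 2 $ 1) * V $ j $ q"
    and "(star S (elem_mat i j P) ** V) $ j $ q =
      star_cnj S (P $ 1 $ 2) * V $ i $ q + star_cnj S (P $ 2 $ 2) * V $ j $ q"
    and "p \<notin> {i, j} \<Longrightarrow> (star S (elem_mat i j P) ** V) $ p $ q = V $ p $ q"
    by (simp_all add: matrix_mult_elem_mat [OF assms] mult.commute)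
qed

lemma mat_1_2: "(mat 1 :: complex^2^2) $ 1 $ 1 = 1" "(mat 1 :: complex^2^2) $ 1 $ 2 = 0"
  "(mat 1 :: complex^2^2) $ 2 $ 1 = 0" "(mat 1 :: complex^2^2) $ 2 $ 2 = 1"
  by (simp_all add: mat_def)
lemma elem_mat_1: assumes "i \<noteq> j" shows "elem_mat i j (mat 1) = (mat 1 :: complex^'n::finite^'n)"
proof -
  have "elem_mat i j (mat 1) $ p $ q = (mat 1 :: complex^'n^'n) $ p $ q" for p q
    unfolding elem_mat_def vec_lambda_beta mat_1_2 unfolding mat_def vec_lambda_beta using assms by (cases "p = q"; cases "p = i"; cases "p = j") simp_all
  then show ?thesis by (simp add: vec_eq_iff)
qed

lemma gam_sum_le:
  assumes "i \<noteq> j"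
  shows "gam S L B X i j i + gam S L B X i j j \<le> (\<Sum>l = 1..L. (norm (W_mat S (B l) X))\<^sup>2)"
  unfolding gam_def sum.distrib [symmetric]
  by (rule sum_mono, subst norm_matrix_power2_split [OF assms])
     (simp add: sum_nonneg sum.distrib algebra_simps)

lemma gam_nonneg: "gam S L B X i j k \<ge> 0"
  by (simp add: gam_def sum_nonneg)

text \<open>Row and column i are scaled by |z|, row and column j by 1/|z|. The entries (i,j) and
  (j,i) get both factors and keep their modulus, and the diagonal does not count. The constant K
  stays anonymous because only differences of the cost are used.\<close>

lemma cost_mult_Psi_D:
  fixes X :: "complex^'n::finite^'n"
  assumes "i \<noteq> j"
  obtains K where "\<And>x y. (x, y) \<noteq> (0, 0) \<Longrightarrow> elem_fun (cost S L B) X i j Psi_D (x, y) =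
     K + (x\<^sup>2 + y\<^sup>2) * gam S L B X i j i + gam S L B X i j j / (x\<^sup>2 + y\<^sup>2)"
proof
  fix x y :: real
  assume xy: "(x, y) \<noteq> (0, 0)"
  let ?z = "Complex x y"
  let ?W = "\<lambda>l. W_mat S (B l) X"
  let ?E = "elem_mat i j (Psi_D (x, y))"
  let ?K = "\<lambda>l. (cmod (?W l $ i $ j))\<^sup>2 + (cmod (?W l $ j $ i))\<^sup>2 +
    (\<Sum>p\<in>UNIV - {i, j}. \<Sum>q\<in>UNIV - {i, j}. (cmod (offdiag (?W l) $ p $ q))\<^sup>2)"
  let ?a = "\<lambda>l k. \<Sum>p\<in>UNIV - {i, j}. (cmod (?W l $ k $ p))\<^sup>2 + (cmod (?W l $ p $ k))\<^sup>2"
  have z: "(cmod ?z)\<^sup>2 = x\<^sup>2 + y\<^sup>2" "?z \<noteq> 0"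
    using xy by (auto simp: cmod_power2 complex_eq_iff)
  have P: "Psi_D (x, y) $ 1 $ 1 = ?z" "Psi_D (x, y) $ 1 $ 2 = 0" "Psi_D (x, y) $ 2 $ 1 = 0"
    "Psi_D (x, y) $ 2 $ 2 = 1 / ?z"
    by (simp_all add: Psi_D_def)
  have one: "cmod ?z * cmod (1 / ?z) = 1"
    using z(2) by (simp add: norm_divide)
  have "(norm (offdiag (star S ?E ** ?W l ** ?E)))\<^sup>2 =
    ?K l + (x\<^sup>2 + y\<^sup>2) * ?a l i + ?a l j / (x\<^sup>2 + y\<^sup>2)" for l
  proof -
    let ?V = "offdiag (star S ?E ** ?W l ** ?E)"
    have 1: "(cmod (?V $ i $ p))\<^sup>2 + (cmod (?V $ p $ i))\<^sup>2 =
        (x\<^sup>2 + y\<^sup>2) * ((cmod (?W l $ i $ p))\<^sup>2 + (cmod (?W l $ p $ i))\<^sup>2)"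
      if "p \<in> UNIV - {i, j}" for p
      using that by (auto simp: offdiag_def matrix_mult_elem_mat [OF assms] star_elem_mat_mult [OF assms]
          P norm_mult power_mult_distrib z algebra_simps)
    have 2: "(cmod (?V $ j $ p))\<^sup>2 + (cmod (?V $ p $ j))\<^sup>2 =
        ((cmod (?W l $ j $ p))\<^sup>2 + (cmod (?W l $ p $ j))\<^sup>2) / (x\<^sup>2 + y\<^sup>2)"
      if "p \<in> UNIV - {i, j}" for p
      using that by (auto simp: offdiag_def matrix_mult_elem_mat [OF assms] star_elem_mat_mult [OF assms]
          P norm_mult norm_divide power_mult_distrib power_divide z add_divide_distrib)
    have 3: "?V $ p $ q = offdiag (?W l) $ p $ q" if "p \<in> UNIV - {i, j}" "q \<in> UNIV - {i, j}" for p q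
      using that by (auto simp: offdiag_def matrix_mult_elem_mat [OF assms] star_elem_mat_mult [OF assms])
    have 4: "cmod (?V $ i $ j) = cmod (?W l $ i $ j)" "cmod (?V $ j $ i) = cmod (?W l $ j $ i)"
      "?V $ i $ i = 0" "?V $ j $ j = 0"
      using assms one
      by (auto simp: offdiag_def matrix_mult_elem_mat [OF assms] star_elem_mat_mult [OF assms] P norm_mult
          norm_divide)
    have "(\<Sum>p\<in>UNIV - {i, j}. (cmod (?V $ i $ p))\<^sup>2 + (cmod (?V $ p $ i))\<^sup>2) = (x\<^sup>2 + y\<^sup>2) * ?a l i"
      unfolding sum_distrib_left by (rule sum.cong [OF refl 1])
    moreover have "(\<Sum>p\<in>UNIV - {i, j}. (cmod (?V $ j $ p))\<^sup>2 + (cmod (?V $ p $ j))\<^sup>2) =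
        ?a l j / (x\<^sup>2 + y\<^sup>2)"
      unfolding sum_divide_distrib by (rule sum.cong [OF refl 2])
    moreover have "(\<Sum>p\<in>UNIV - {i, j}. \<Sum>q\<in>UNIV - {i, j}. (cmod (?V $ p $ q))\<^sup>2) =
        (\<Sum>p\<in>UNIV - {i, j}. \<Sum>q\<in>UNIV - {i, j}. (cmod (offdiag (?W l) $ p $ q))\<^sup>2)"
      by (intro sum.cong refl) (simp only: 3)
    ultimately show ?thesis
      by (subst norm_matrix_power2_split [OF assms]) (simp only: 4 norm_zero, simp)
  qed
  then show "elem_fun (cost S L B) X i j Psi_D (x, y) =
     (\<Sum>l = 1..L. ?K l) + (x\<^sup>2 + y\<^sup>2) * gam S L B X i j i + gam S L B X i j j / (x\<^sup>2 + y\<^sup>2)"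
    by (simp add: elem_fun_def cost_mult gam_def sum.distrib flip: sum_distrib_left sum_divide_distrib)
qed

text \<open>Unclipped, x^4 = \<gamma>2/\<gamma>1 minimizes the function, and the gain is the squared
  difference of the square roots of \<gamma>1 and \<gamma>2. Clipped, one coefficient is at most
  \<sigma> times the other, and dividing the larger one by 4 pays for multiplying the smaller one by
  4.\<close>

lemma step_D_decrease:
  fixes \<gamma>1 \<gamma>2 :: real
  assumes "0 < \<sigma>" "\<sigma> < 1 / 4" "\<gamma>1 \<ge> 0" "\<gamma>2 \<ge> 0" "\<gamma>1 + \<gamma>2 \<le> C" "C > 0"
  defines "x \<equiv> step_D \<sigma> \<gamma>1 \<gamma>2"
  shows "x > 0"
    and "(1 - 4 * \<sigma>) / (2 * C) * (\<gamma>1 - \<gamma>2)\<^sup>2 \<le> (\<gamma>1 + \<gamma>2) - (x\<^sup>2 * \<gamma>1 + \<gamma>2 / x\<^sup>2)"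
proof -
  \<comment> \<open>Here b is the coefficient divided by 4 and a the one multiplied by 4, so the
    right side is the exact gain of a clipped step; a \<le> \<sigma> b makes it at least 3/4 (1 -
    4\<sigma>) b.\<close>
  have half: "(1 - 4 * \<sigma>) / (2 * C) * (b - a)\<^sup>2 \<le> 3 / 4 * b - 3 * a"
    if "0 \<le> a" "a \<le> \<sigma> * b" "b \<le> C" "0 \<le> b" for a b
  proof -
    have "a \<le> b"
      using that assms mult_right_mono [of \<sigma> 1 b] by auto
    then have "(b - a)\<^sup>2 \<le> b * C"
      using that by (auto simp: power2_eq_square intro!: mult_mono)
    then have "(1 - 4 * \<sigma>) / (2 * C) * (b - a)\<^sup>2 \<le> (1 - 4 * \<sigma>) / (2 * C) * (b * C)"
      using assms by (intro mult_left_mono) auto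
    also have "\<dots> = (1 - 4 * \<sigma>) / 2 * b"
      using \<open>C > 0\<close> by simp
    also have "\<dots> \<le> 3 / 4 * (1 - 4 * \<sigma>) * b"
      using that assms by (intro mult_right_mono) auto
    also have "\<dots> \<le> 3 / 4 * b - 3 * a"
      using that(2) by (simp add: left_diff_distrib right_diff_distrib)
    finally show ?thesis .
  qed
  have two: "(1 - 4 * \<sigma>) / (2 * C) * (\<gamma>1 - \<gamma>2)\<^sup>2 \<le> (\<gamma>1 + \<gamma>2) - (2\<^sup>2 * \<gamma>1 + \<gamma>2 / 2\<^sup>2)"
    if "\<gamma>1 \<le> \<sigma> * \<gamma>2"
    using half [of \<gamma>1 \<gamma>2] that assms by (simp add: power2_commute [of \<gamma>1])
  consider "\<gamma>1 = 0" "\<gamma>2 = 0" "x = 1" | "\<gamma>1 = 0" "\<gamma>2 > 0" "x = 2"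
    | "\<gamma>1 > 0" "\<gamma>2 / \<gamma>1 < \<sigma>" "x = 1 / 2" | "\<gamma>1 > 0" "\<gamma>2 / \<gamma>1 > 1 / \<sigma>" "x = 2"
    | "\<gamma>1 > 0" "\<gamma>2 / \<gamma>1 \<ge> \<sigma>" "x = (\<gamma>2 / \<gamma>1) powr (1 / 4)"
  proof -
    have x: "x = (if \<gamma>1 = 0 \<and> \<gamma>2 = 0 then 1 else if \<gamma>1 = 0 then 2 else if \<gamma>2 / \<gamma>1 < \<sigma> then 1 / 2
      else if \<gamma>2 / \<gamma>1 > 1 / \<sigma> then 2 else (\<gamma>2 / \<gamma>1) powr (1 / 4))"
      by (simp add: x_def step_D_def Let_def)
    show ?thesis
    proof (cases "\<gamma>1 = 0")
      case True
      show ?thesis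
      proof (cases "\<gamma>2 = 0")
        case True
        show ?thesis
          by (rule that(1)) (simp_all only: x True \<open>\<gamma>1 = 0\<close> simp_thms if_True)
      next
        case False
        then have "\<gamma>2 > 0"
          using assms(4) by linarith
        then show ?thesis
          by (intro that(2)) (simp_all add: x True)
      qed
    next
      case False
      then have "\<gamma>1 > 0"
        using assms(3) by linarith
      show ?thesis
      proof (cases "\<gamma>2 / \<gamma>1 < \<sigma>")
        case True
        then have "x = 1 / 2"
          by (simp only: x False simp_thms if_True if_False)
        with \<open>\<gamma>1 > 0\<close> True show ?thesis
          by (rule that(3))
      next
        case low: False
        show ?thesis
        proof (cases "\<gamma>2 / \<gamma>1 > 1 / \<sigma>")
          case True
          then have "x = 2"
            by (simp only: x False low simp_thms if_True if_False)
          with \<open>\<gamma>1 > 0\<close> True show ?thesis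
            by (rule that(4))
        next
          case high: False
          then have "x = (\<gamma>2 / \<gamma>1) powr (1 / 4)"
            by (simp only: x False low simp_thms if_True if_False)
          with \<open>\<gamma>1 > 0\<close> low show ?thesis
            by (intro that(5)) simp_all
        qed
      qed
    qed
  qed
  then have "x > 0 \<and> (1 - 4 * \<sigma>) / (2 * C) * (\<gamma>1 - \<gamma>2)\<^sup>2 \<le> (\<gamma>1 + \<gamma>2) - (x\<^sup>2 * \<gamma>1 + \<gamma>2 / x\<^sup>2)"
  proof cases
    case 1
    then show ?thesis by simp
  next
    case 2
    then show ?thesis using two assms by simp
  next
    case 3
    then have "\<gamma>2 \<le> \<sigma> * \<gamma>1"
      by (simp add: divide_less_eq)
    then show ?thesis
      using half [of \<gamma>2 \<gamma>1] assms(1-6) 3(1) unfolding 3(3) by (simp add: power2_eq_square)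
  next
    case 4
    then have "\<gamma>1 \<le> \<sigma> * \<gamma>2"
      using assms by (simp add: field_simps)
    then show ?thesis
      using two 4 by simp
  next
    case 5
    \<comment> \<open>With the square roots a and b, x^2 = b/a makes both terms of the new value
      equal to ab, the equality case of the inequality of arithmetic and geometric means.\<close>
    define a b where "a = sqrt \<gamma>1" and "b = sqrt \<gamma>2"
    have "\<gamma>2 / \<gamma>1 > 0"
      using 5 assms by linarith
    then have pos: "\<gamma>1 > 0" "\<gamma>2 > 0"
      using 5 by (auto simp: zero_less_divide_iff)
    then have ab: "a > 0" "b > 0" "\<gamma>1 = a\<^sup>2" "\<gamma>2 = b\<^sup>2"
      by (simp_all add: a_def b_def)
    have "x\<^sup>2 = (\<gamma>2 / \<gamma>1) powr (1 / 2)"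
      using \<open>\<gamma>2 / \<gamma>1 > 0\<close> 5 by (simp add: power2_eq_square powr_add [symmetric])
    also have "\<dots> = b / a"
      using \<open>\<gamma>2 / \<gamma>1 > 0\<close> by (simp add: powr_half_sqrt real_sqrt_divide a_def b_def)
    finally have x2: "x\<^sup>2 = b / a" .
    have "x\<^sup>2 * \<gamma>1 + \<gamma>2 / x\<^sup>2 = 2 * a * b"
      unfolding x2 ab(3,4) using ab(1,2) by (simp add: power2_eq_square)
    then have eq: "(\<gamma>1 + \<gamma>2) - (x\<^sup>2 * \<gamma>1 + \<gamma>2 / x\<^sup>2) = (a - b)\<^sup>2"
      by (simp add: ab power2_diff)
    \<comment> \<open>Needed because \<gamma>1 - \<gamma>2 = (a - b)(a + b): bounding the second
      factor turns the gain (a - b)^2 into a multiple of (\<gamma>1 - \<gamma>2)^2.\<close>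
    have "(a + b)\<^sup>2 \<le> 2 * C"
      using assms(5) sum_squares_bound [of a b] by (simp add: ab power2_sum)
    then have "(a - b)\<^sup>2 * (a + b)\<^sup>2 \<le> (a - b)\<^sup>2 * (2 * C)"
      by (intro mult_left_mono) auto
    then have "(\<gamma>1 - \<gamma>2)\<^sup>2 / (2 * C) \<le> (a - b)\<^sup>2"
    proof -
      have "\<gamma>1 - \<gamma>2 = (a - b) * (a + b)"
        by (simp add: ab power2_eq_square algebra_simps)
      then have "(\<gamma>1 - \<gamma>2)\<^sup>2 = (a - b)\<^sup>2 * (a + b)\<^sup>2"
        by (simp add: power_mult_distrib)
      then show ?thesis
        using \<open>C > 0\<close> \<open>(a - b)\<^sup>2 * (a + b)\<^sup>2 \<le> (a - b)\<^sup>2 * (2 * C)\<close>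
        by (simp only: pos_divide_le_eq zero_less_mult_iff zero_less_numeral simp_thms)
    qed
    moreover have "(1 - 4 * \<sigma>) * ((\<gamma>1 - \<gamma>2)\<^sup>2 / (2 * C)) \<le> 1 * ((\<gamma>1 - \<gamma>2)\<^sup>2 / (2 * C))"
      using assms by (intro mult_right_mono) auto
    moreover have "x > 0"
      using pos 5(3) by simp
    ultimately show ?thesis
      unfolding eq by simp
  qed
  then show "x > 0"
    and "(1 - 4 * \<sigma>) / (2 * C) * (\<gamma>1 - \<gamma>2)\<^sup>2 \<le> (\<gamma>1 + \<gamma>2) - (x\<^sup>2 * \<gamma>1 + \<gamma>2 / x\<^sup>2)"
    by auto
qed

text \<open>At z = 1 the gradient is (2(\<gamma>1 - \<gamma>2), 0), since only |z| matters. Its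
  squared norm contributes the factor 4 that turns 2C into 8C.\<close>

lemma sufficient_decrease_D:
  fixes X :: "complex^'n::finite^'n"
  assumes "i \<noteq> j" and C: "(\<Sum>l = 1..L. (norm (W_mat S (B l) X))\<^sup>2) \<le> C" "C > 0"
    and \<sigma>: "0 < \<sigma>" "\<sigma> < 1 / 4"
    and P: "P = Psi_D (step_D \<sigma> (gam S L B X i j i) (gam S L B X i j j), 0)"
  shows "(1 - 4 * \<sigma>) / (8 * C) * (norm (euclid_grad (elem_fun (cost S L B) X i j Psi_D) (1, 0)))\<^sup>2
    \<le> cost S L B X - cost S L B (X ** elem_mat i j P)"
proof -
  let ?h = "elem_fun (cost S L B) X i j Psi_D"
  let ?g1 = "gam S L B X i j i" and ?g2 = "gam S L B X i j j"
  let ?x = "step_D \<sigma> ?g1 ?g2"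
  obtain K where h: "\<And>x y. (x, y) \<noteq> (0, 0) \<Longrightarrow> ?h (x, y) = K + (x\<^sup>2 + y\<^sup>2) * ?g1 + ?g2 / (x\<^sup>2 + y\<^sup>2)"
    using cost_mult_Psi_D [OF \<open>i \<noteq> j\<close>] by blast
  have "((\<lambda>a. K + ((fst a)\<^sup>2 + (snd a)\<^sup>2) * ?g1 + ?g2 / ((fst a)\<^sup>2 + (snd a)\<^sup>2)) has_derivative
      (\<lambda>a. 2 * (?g1 - ?g2) * fst a)) (at (1, 0))"
    by (auto intro!: derivative_eq_intros simp: algebra_simps)
  \<comment> \<open>The closed form is available only for z \<noteq> 0, so the derivative is
    transferred on this open set.\<close>
  moreover have "open (- {(0, 0) :: real \<times> real})"
    by (simp add: open_Compl)
  ultimately have "(?h has_derivative (\<lambda>a. 2 * (?g1 - ?g2) * fst a)) (at (1, 0))"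
  proof (rule has_derivative_transform_within_open)
    fix a :: "real \<times> real"
    assume "a \<in> - {(0, 0)}"
    then show "K + ((fst a)\<^sup>2 + (snd a)\<^sup>2) * ?g1 + ?g2 / ((fst a)\<^sup>2 + (snd a)\<^sup>2) = ?h a"
      using h [of "fst a" "snd a"] by (cases a) simp
  qed simp
  then have "euclid_grad ?h (1, 0) = (2 * (?g1 - ?g2), 0)"
    by (subst euclid_grad_has_derivative) 
       (auto simp: Basis_prod_def sum.union_disjoint sum.reindex inj_on_def)
  then have grad: "(norm (euclid_grad ?h (1, 0)))\<^sup>2 = 4 * (?g1 - ?g2)\<^sup>2"
    by (simp add: norm_Pair) (simp add: power2_eq_square algebra_simps)
  have "?g1 + ?g2 \<le> C"
    using gam_sum_le [OF \<open>i \<noteq> j\<close>] C(1) by (rule order_trans)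
  note D = step_D_decrease [OF \<sigma> gam_nonneg gam_nonneg this C(2)]
  have "Complex 1 0 = 1"
    by (simp add: complex_eq_iff)
  then have "Psi_D (1, 0) = mat 1"
    by (simp add: vec_eq_iff forall_2 mat_1_2 Psi_D_def)
  then have "elem_mat i j (Psi_D (1, 0)) = (mat 1 :: complex^'n^'n)"
    using \<open>i \<noteq> j\<close> by (simp add: elem_mat_1)
  then have "?h (1, 0) = cost S L B X"
    by (simp add: elem_fun_def)
  moreover have "?h (?x, 0) = cost S L B (X ** elem_mat i j P)"
    by (simp add: elem_fun_def P)
  ultimately have "cost S L B X - cost S L B (X ** elem_mat i j P) =
     (?g1 + ?g2) - (?x\<^sup>2 * ?g1 + ?g2 / ?x\<^sup>2)"
    using h [of 1 0] h [of ?x 0] D(1) by simp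
  with D(2) show ?thesis
    by (simp add: grad)
qed

subsection \<open>Quadratic forms on the unit sphere\<close>

lemma inner_3: "(x :: real^3) \<bullet> y = x$1 * y$1 + x$2 * y$2 + x$3 * y$3"
  by (simp add: inner_vec_def sum_3)

text \<open>A zero of a nonnegative form is a minimum, so the form has no negative slope there;
  moving from x against A x would give one unless A x = 0.\<close>

lemma psd_form_kernel:
  fixes A :: "real^'n^'n"
  assumes sym: "transpose A = A" and psd: "\<And>y. y \<bullet> (A *v y) \<ge> 0" and x: "x \<bullet> (A *v x) = 0"
  shows "A *v x = 0"
proof -
  let ?y = "A *v x"
  have swap: "x \<bullet> (A *v ?y) = ?y \<bullet> ?y"
    by (simp add: dot_lmul_matrix [symmetric] transpose_matrix_vector [symmetric] sym)
  have *: "0 \<le> 2 * t * (?y \<bullet> ?y) + t\<^sup>2 * (?y \<bullet> (A *v ?y))" for t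
  proof -
    have "0 \<le> (x + t *\<^sub>R ?y) \<bullet> (A *v (x + t *\<^sub>R ?y))"
      by (rule psd)
    also have "\<dots> = 2 * t * (?y \<bullet> ?y) + t\<^sup>2 * (?y \<bullet> (A *v ?y))"
      by (simp add: matrix_vector_right_distrib matrix_vector_mult_scaleR inner_add_left inner_add_right
          x swap power2_eq_square algebra_simps)
    finally show ?thesis .
  qed
  show ?thesis
  proof (rule ccontr)
    assume "?y \<noteq> 0"
    define b c where "b = ?y \<bullet> ?y" and "c = ?y \<bullet> (A *v ?y)"
    have "b > 0" "c \<ge> 0"
      using \<open>?y \<noteq> 0\<close> psd by (auto simp: b_def c_def)
    \<comment> \<open>A step short enough for the linear term to dominate; adding b to the
      denominator keeps it defined when c = 0.\<close>
    define t where "t = b / (c + b)"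
    have "t > 0" "t * c \<le> b"
      using \<open>b > 0\<close> \<open>c \<ge> 0\<close> by (simp_all add: t_def divide_le_eq)
    have "0 \<le> 2 * (- t) * b + (- t)\<^sup>2 * c"
      using * unfolding b_def c_def .
    also have "\<dots> = t * (t * c - 2 * b)"
      by (simp add: algebra_simps power2_eq_square)
    also have "\<dots> < 0"
      using \<open>b > 0\<close> \<open>t > 0\<close> \<open>t * c \<le> b\<close> by (intro mult_pos_neg) auto
    finally show False
      by simp
  qed
qed

text \<open>The hypothesis on u compares eigenvalues only. The maximum m of the form on the sphere
  is attained by compactness, and \<open>m *\<^sub>R mat 1 - A\<close> is positive semidefinite with
  a zero at the maximizer. So m is an eigenvalue, and therefore at most the one belonging to
  u.\<close>

lemma form_le_top_eigenvalue:
  fixes A :: "real^'n^'n"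
  assumes sym: "transpose A = A" and u: "top_unit_eigenvector A u" and y: "norm y = 1"
  shows "y \<bullet> (A *v y) \<le> u \<bullet> (A *v u)"
proof -
  have "compact (sphere (0 :: real^'n) 1)" "sphere (0 :: real^'n) 1 \<noteq> {}"
    using y by auto
  moreover have "continuous_on (sphere 0 1) (\<lambda>y. y \<bullet> (A *v y))"
    by (intro continuous_intros linear_continuous_on matrix_vector_mul_bounded_linear)
  ultimately obtain x where x: "norm x = 1" and max: "\<And>y. norm y = 1 \<Longrightarrow> y \<bullet> (A *v y) \<le> x \<bullet> (A *v x)"
    using continuous_attains_sup [of "sphere (0 :: real^'n) 1" "\<lambda>y. y \<bullet> (A *v y)"] by auto
  define m where "m = x \<bullet> (A *v x)"
  let ?M = "m *\<^sub>R mat 1 - A"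
  have M: "?M *v y = m *\<^sub>R y - A *v y" for y
    by (simp add: matrix_vector_mult_diff_rdistrib scaleR_matrix_vector_assoc [symmetric])
  have "y \<bullet> (A *v y) \<le> m * (y \<bullet> y)" for y
  proof (cases "y = 0")
    case False
    have "(y /\<^sub>R norm y) \<bullet> (A *v (y /\<^sub>R norm y)) \<le> m"
      using max [of "y /\<^sub>R norm y"] False by (simp add: m_def)
    then show ?thesis
      using False by (simp add: matrix_vector_mult_scaleR field_simps norm_eq_sqrt_inner)
  qed simp
  then have "y \<bullet> (?M *v y) \<ge> 0" for y
    by (simp add: M inner_diff_right)
  moreover have "transpose ?M = ?M"
    using sym by (simp add: vec_eq_iff transpose_def mat_def eq_commute)
  moreover have "x \<bullet> (?M *v x) = 0"
    using x unfolding M inner_diff_right m_def [symmetric] by (simp add: norm_eq_1)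
  ultimately have "?M *v x = 0"
    by (intro psd_form_kernel)
  then have "is_eigenvalue A m"
    using x unfolding is_eigenvalue_def M by (intro exI [of _ x]) auto
  moreover obtain \<nu> where "A *v u = \<nu> *\<^sub>R u" "\<And>\<mu>. is_eigenvalue A \<mu> \<Longrightarrow> \<mu> \<le> \<nu>" "norm u = 1"
    using u by (auto simp: top_unit_eigenvector_def)
  ultimately have "m \<le> u \<bullet> (A *v u)"
    by (simp add: norm_eq_1)
  then show ?thesis
    using max [OF y] by (simp add: m_def)
qed

section \<open>The form along meridians of the sphere\<close>

lemma norm_r_vec [simp]: "norm (r_vec \<theta> \<phi>) = 1"
proof -
  have "r_vec \<theta> \<phi> \<bullet> r_vec \<theta> \<phi> =
     (cos (2 * \<theta>))\<^sup>2 + (sin (2 * \<theta>))\<^sup>2 * (cos \<phi>)\<^sup>2 + (sin (2 * \<theta>))\<^sup>2 * (sin \<phi>)\<^sup>2"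
    by (simp only: inner_3 r_vec_def vector_3 power2_eq_square minus_mult_minus mult_ac)
  also have "\<dots> = (cos (2 * \<theta>))\<^sup>2 + (sin (2 * \<theta>))\<^sup>2 * ((cos \<phi>)\<^sup>2 + (sin \<phi>)\<^sup>2)"
    by (simp only: distrib_left add.assoc)
  finally show ?thesis
    by (simp add: norm_eq_1)
qed

lemma r_vec_form:
  assumes "transpose G = G"
  shows "r_vec \<theta> \<phi> \<bullet> (G *v r_vec \<theta> \<phi>) = (cos (2 * \<theta>))\<^sup>2 * G$1$1
    - 2 * sin (2 * \<theta>) * cos (2 * \<theta>) * (G$1$2 * cos \<phi> + G$1$3 * sin \<phi>)
    + (sin (2 * \<theta>))\<^sup>2 * (vector [0, cos \<phi>, sin \<phi>] \<bullet> (G *v vector [0, cos \<phi>, sin \<phi>]))"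
proof -
  have "G$2$1 = G$1$2" "G$3$1 = G$1$3" "G$3$2 = G$2$3"
    using assms by (simp_all add: vec_eq_iff transpose_def)
  then show ?thesis
    by (simp add: inner_3 r_vec_def matrix_vector_mult_def sum_3 power2_eq_square algebra_simps)
qed

text \<open>
  Moving from the first coordinate vector in the direction of the off-diagonal part of the first
  row, by an angle proportional to its length, already gives the increase asked for.
\<close>
lemma r_vec_form_increase:
  fixes G :: "real^3^3"
  assumes sym: "transpose G = G" and bd: "\<And>y. \<bar>y \<bullet> (G *v y)\<bar> \<le> C * (norm y)\<^sup>2" and "C > 0"
    and v: "G$1$2 = s * cos \<phi>" "G$1$3 = s * sin \<phi>" "s \<ge> 0"
  obtains \<theta> where "\<theta> \<in> {- pi / 4..pi / 4}"
    "s\<^sup>2 / (8 * C) \<le> r_vec \<theta> \<phi> \<bullet> (G *v r_vec \<theta> \<phi>) - G$1$1"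
proof -
  let ?y = "vector [0, cos \<phi>, sin \<phi>] :: real^3"
  let ?e = "vector [1, 0, 0] :: real^3"
  define q where "q = ?y \<bullet> (G *v ?y)"
  have G: "G$2$1 = G$1$2" "G$3$1 = G$1$3" "G$3$2 = G$2$3"
    using sym by (simp_all add: vec_eq_iff transpose_def)
  have s: "G$1$2 * cos \<phi> + G$1$3 * sin \<phi> = s"
    using sin_cos_squared_add3 [of \<phi>] v by (simp add: algebra_simps flip: distrib_left)
  have n: "(norm ?y)\<^sup>2 = 1" "(norm ?e)\<^sup>2 = 1" "(norm (?e + ?y))\<^sup>2 = 2"
    using sin_cos_squared_add3 [of \<phi>] by (simp_all add: power2_norm_eq_inner inner_3)
  have "\<bar>q\<bar> \<le> C"
    using bd [of ?y] n by (simp add: q_def)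
  have "?e \<bullet> (G *v ?e) = G$1$1"
    by (simp add: inner_3 matrix_vector_mult_def sum_3)
  then have "\<bar>G$1$1\<bar> \<le> C"
    using bd [of ?e] n by simp
  \<comment> \<open>Evaluating the form at the sum isolates the cross term 2s, so the bound on the
    form also bounds s, by 2C.\<close>
  have "(?e + ?y) \<bullet> (G *v (?e + ?y)) = G$1$1 + 2 * s + q"
    unfolding q_def s [symmetric]
    by (simp add: inner_3 matrix_vector_mult_def sum_3 G algebra_simps)
  then have "\<bar>G$1$1 + 2 * s + q\<bar> \<le> 2 * C"
    using bd [of "?e + ?y"] n by simp
  then have "s \<le> 2 * C"
    using \<open>\<bar>q\<bar> \<le> C\<close> \<open>\<bar>G$1$1\<bar> \<le> C\<close> by linarith
  \<comment> \<open>The value of -sin 2\<theta>. It maximizes x s - 2C x^2, the lower bound for the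
    gain once cos 2\<theta> is replaced by 1/2; since s \<le> 2C it is at most 1/2, which justifies
    that replacement.\<close>
  define x where "x = s / (4 * C)"
  have x: "0 \<le> x" "x \<le> 1 / 2"
    using \<open>s \<le> 2 * C\<close> \<open>C > 0\<close> \<open>s \<ge> 0\<close> by (simp_all add: x_def divide_le_eq)
  define \<theta> where "\<theta> = - arcsin x / 2"
  have \<theta>: "sin (2 * \<theta>) = - x" "cos (2 * \<theta>) = sqrt (1 - x\<^sup>2)"
    using x by (simp_all add: \<theta>_def cos_arcsin)
  have "x\<^sup>2 \<le> (1 / 2)\<^sup>2"
    using x by (intro power_mono)
  then have "sqrt ((1 / 2)\<^sup>2) \<le> sqrt (1 - x\<^sup>2)"
    by (simp add: power2_eq_square)
  then have c: "1 / 2 \<le> cos (2 * \<theta>)"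
    unfolding \<theta> by simp
  have c2: "(cos (2 * \<theta>))\<^sup>2 = 1 - x\<^sup>2"
    using \<theta>(1) sin_cos_squared_add [of "2 * \<theta>"] by simp
  have "r_vec \<theta> \<phi> \<bullet> (G *v r_vec \<theta> \<phi>) - G$1$1 = 2 * x * cos (2 * \<theta>) * s + x\<^sup>2 * (q - G$1$1)"
    unfolding r_vec_form [OF sym] s q_def [symmetric] c2 unfolding \<theta>(1)
    by (simp add: algebra_simps)
  also have "\<dots> \<ge> 2 * x * (1 / 2) * s + x\<^sup>2 * (- 2 * C)"
    using \<open>\<bar>q\<bar> \<le> C\<close> \<open>\<bar>G$1$1\<bar> \<le> C\<close> c x \<open>s \<ge> 0\<close>
    by (intro add_mono mult_mono mult_left_mono) auto
  also have "2 * x * (1 / 2) * s + x\<^sup>2 * (- 2 * C) = s\<^sup>2 / (8 * C)"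
    using \<open>C > 0\<close> by (simp add: x_def power2_eq_square field_simps)
  finally have "s\<^sup>2 / (8 * C) \<le> r_vec \<theta> \<phi> \<bullet> (G *v r_vec \<theta> \<phi>) - G$1$1" .
  moreover have "\<theta> \<in> {- pi / 4..pi / 4}"
    using x arcsin_bounded [of x] by (auto simp: \<theta>_def)
  ultimately show ?thesis
    using that by blast
qed

text \<open>Both branches are measured against the point of \<open>r_vec_form_increase\<close>: the
  top eigenvector beats every point of the sphere, and the arc maximizer beats every admissible
  point of its meridian, which is the gradient meridian.\<close>

lemma step_Q_increase:
  fixes G :: "real^3^3"
  assumes sym: "transpose G = G" and bd: "\<And>y. \<bar>y \<bullet> (G *v y)\<bar> \<le> C * (norm y)\<^sup>2" and "C > 0"
    and step: "step_Q \<sigma> G \<theta> \<phi>"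
  shows "((G$1$2)\<^sup>2 + (G$1$3)\<^sup>2) / (8 * C) \<le> r_vec \<theta> \<phi> \<bullet> (G *v r_vec \<theta> \<phi>) - G$1$1"
proof -
  define s where "s = sqrt ((G$1$2)\<^sup>2 + (G$1$3)\<^sup>2)"
  have s: "s\<^sup>2 = (G$1$2)\<^sup>2 + (G$1$3)\<^sup>2" "s \<ge> 0"
    by (simp_all add: s_def)
  obtain \<phi>' where \<phi>': "G$1$2 = s * cos \<phi>'" "G$1$3 = s * sin \<phi>'"
  proof (cases "s = 0")
    case True
    then have "G$1$2 = 0" "G$1$3 = 0"
      using s by (simp_all add: sum_power2_eq_zero_iff)
    then show ?thesis
      using that [of 0] True by simp
  next
    case False
    then have "(G$1$2 / s)\<^sup>2 + (G$1$3 / s)\<^sup>2 = 1"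
      using s(1) [symmetric] by (simp add: power_divide flip: add_divide_distrib)
    then obtain t where "G$1$2 / s = cos t" "G$1$3 / s = sin t"
      using sincos_total_2pi by metis
    then show ?thesis
      using that [of t] False by (simp add: field_simps)
  qed
  obtain u where u: "top_unit_eigenvector G u"
    and *: "r_vec \<theta> \<phi> = u \<or> (cos \<phi>, sin \<phi>) = (G$1$2, G$1$3) /\<^sub>R norm (G$1$2, G$1$3) \<and>
      is_arg_max (\<lambda>t. r_vec t \<phi> \<bullet> (G *v r_vec t \<phi>)) (\<lambda>t. t \<in> {- pi / 4..pi / 4}) \<theta>"
    using step by (auto simp: step_Q_def Let_def split: if_splits)
  from * have "s\<^sup>2 / (8 * C) \<le> r_vec \<theta> \<phi> \<bullet> (G *v r_vec \<theta> \<phi>) - G$1$1"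
  proof (elim disjE conjE)
    assume r: "r_vec \<theta> \<phi> = u"
    obtain \<theta>' where "s\<^sup>2 / (8 * C) \<le> r_vec \<theta>' \<phi>' \<bullet> (G *v r_vec \<theta>' \<phi>') - G$1$1"
      using r_vec_form_increase [OF sym bd \<open>C > 0\<close> \<phi>' \<open>s \<ge> 0\<close>] by blast
    then show ?thesis
      using form_le_top_eigenvalue [OF sym u norm_r_vec [of \<theta>' \<phi>']] r by simp
  next
    assume eq: "(cos \<phi>, sin \<phi>) = (G$1$2, G$1$3) /\<^sub>R norm (G$1$2, G$1$3)"
      and max: "is_arg_max (\<lambda>t. r_vec t \<phi> \<bullet> (G *v r_vec t \<phi>)) (\<lambda>t. t \<in> {- pi / 4..pi / 4}) \<theta>"
    have "norm (G$1$2, G$1$3) = s"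
      by (simp add: norm_Pair s_def)
    with eq have \<phi>: "cos \<phi> = inverse s * G$1$2" "sin \<phi> = inverse s * G$1$3"
      by simp_all
    \<comment> \<open>If s were 0, then inverse s = 0 and both cos \<phi> and sin \<phi> would
      vanish.\<close>
    moreover have "s \<noteq> 0"
      using \<phi> sin_cos_squared_add [of \<phi>] by auto
    ultimately have "G$1$2 = s * cos \<phi>" "G$1$3 = s * sin \<phi>"
      by simp_all
    from r_vec_form_increase [OF sym bd \<open>C > 0\<close> this \<open>s \<ge> 0\<close>]
    obtain \<theta>' where "\<theta>' \<in> {- pi / 4..pi / 4}" "s\<^sup>2 / (8 * C) \<le> r_vec \<theta>' \<phi> \<bullet> (G *v r_vec \<theta>' \<phi>) - G$1$1"
      by blast
    then show ?thesis
      using max unfolding is_arg_max_linorder by force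
  qed
  then show ?thesis
    by (simp add: s)
qed

subsection \<open>Rotation steps\<close>

lemma norm_power2_eq_trace: "of_real ((norm (A :: complex^'n^'m))\<^sup>2) = trace (A ** ctransp A)"
  by (simp add: norm_matrix_power2 trace_def matrix_matrix_mult_def ctransp_def complex_norm_square
      del: of_real_power)

lemma norm_mult_unitary:
  fixes A :: "complex^'n^'m"
  assumes "U ** ctransp U = mat 1"
  shows "norm (A ** U) = norm A"
proof -
  have "(A ** U) ** ctransp (A ** U) = A ** (U ** ctransp U) ** ctransp A"
    using star_matrix_mult [of Herm A U] by (simp add: matrix_mul_assoc)
  also have "\<dots> = A ** ctransp A"
    by (simp add: assms)
  finally have "of_real ((norm (A ** U))\<^sup>2) = (of_real ((norm A)\<^sup>2) :: complex)"
    by (simp only: norm_power2_eq_trace)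
  then show ?thesis
    by (simp only: of_real_eq_iff power2_eq_iff_nonneg norm_ge_zero)
qed

lemma norm_star [simp]: "norm (star S A) = norm A"
proof -
  have "(norm (star S A))\<^sup>2 = (norm A)\<^sup>2"
    unfolding norm_matrix_power2 star_nth cmod_star_cnj by (rule sum.swap)
  then show ?thesis
    by simp
qed

text \<open>\<open>star S\<close> preserves the norm and moves the left factor to the right, so the
  case of the transpose needs no separate statement about the transpose of U.\<close>

lemma norm_conj_unitary:
  assumes "U ** ctransp U = mat 1"
  shows "norm (star S U ** A ** U) = norm A"
proof -
  have "norm (star S U ** A) = norm (star S (star S A ** U))"
    by (simp add: star_matrix_mult)
  then show ?thesis
    by (simp add: norm_mult_unitary [OF assms])
qed

lemma matrix_mult_2: "((P :: complex^2^2) ** Q) $ a $ b = P $ a $ 1 * Q $ 1 $ b + P $ a $ 2 * Q $ 2 $ b"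
  by (simp add: matrix_matrix_mult_def sum_2)

lemma elem_mat_mult:
  fixes i j :: "'n::finite"
  assumes "i \<noteq> j"
  shows "elem_mat i j P ** elem_mat i j Q = elem_mat i j (P ** Q)"
proof -
  have "(elem_mat i j P ** elem_mat i j Q) $ p $ q = elem_mat i j (P ** Q) $ p $ q" for p q
    using assms
    by (cases "q = i"; cases "q = j")
      (simp_all add: matrix_mult_elem_mat matrix_mult_2, simp_all add: elem_mat_def matrix_mult_2)
  then show ?thesis
    by (simp add: vec_eq_iff)
qed

lemma ctransp_elem_mat:
  fixes i j :: "'n::finite"
  assumes "i \<noteq> j"
  shows "ctransp (elem_mat i j P) = elem_mat i j (ctransp P)"
proof -
  have "ctransp (elem_mat i j P) $ p $ q = elem_mat i j (ctransp P) $ p $ q" for p q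
    unfolding ctransp_def elem_mat_def vec_lambda_beta using assms
    by (cases "p = q"; cases "p = i"; cases "p = j"; cases "q = i"; cases "q = j") simp_all
  then show ?thesis
    by (simp add: vec_eq_iff)
qed

definition block :: "'n \<Rightarrow> 'n \<Rightarrow> complex^'n^'n \<Rightarrow> complex^2^2" where
  "block i j W = vector [vector [W $ i $ i, W $ i $ j], vector [W $ j $ i, W $ j $ j]]"

lemma block_nth [simp]:
  "block i j W $ 1 $ 1 = W $ i $ i" "block i j W $ 1 $ 2 = W $ i $ j"
  "block i j W $ 2 $ 1 = W $ j $ i" "block i j W $ 2 $ 2 = W $ j $ j"
  by (simp_all add: block_def)

lemma z_vec_block: "z_vec S i j W = z_vec S 1 2 (block i j W)"
  by (cases S) simp_all

lemma block_conj_elem_mat: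
  fixes W :: "complex^'n::finite^'n"
  assumes "i \<noteq> j"
  shows "block i j (star S (elem_mat i j P) ** W ** elem_mat i j P) = star S P ** block i j W ** P"
  by (simp add: vec_eq_iff forall_2 matrix_mult_2 matrix_mult_elem_mat [OF assms]
      star_elem_mat_mult [OF assms])

text \<open>Since a unitary congruence keeps the full norm, lowering the off-diagonal part amounts
  to raising the diagonal part.\<close>

lemma norm_offdiag_power2:
  "(norm (offdiag A))\<^sup>2 = (norm A)\<^sup>2 - (\<Sum>p\<in>UNIV. (cmod (A $ p $ p))\<^sup>2)"
proof -
  have "(\<Sum>q\<in>UNIV. (cmod (A $ p $ q))\<^sup>2) =
      (\<Sum>q\<in>UNIV. (cmod (offdiag A $ p $ q))\<^sup>2) + (cmod (A $ p $ p))\<^sup>2" for p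
    by (subst (1 2) sum.remove [of UNIV p]) (auto simp: offdiag_def intro!: sum.cong)
  then show ?thesis
    by (simp add: norm_matrix_power2 sum.distrib)
qed

lemma Psi_Q_nth [simp]:
  "Psi_Q (c, s1, s2) $ 1 $ 1 = of_real c" "Psi_Q (c, s1, s2) $ 1 $ 2 = - Complex s1 s2"
  "Psi_Q (c, s1, s2) $ 2 $ 1 = Complex s1 (- s2)" "Psi_Q (c, s1, s2) $ 2 $ 2 = of_real c"
  by (simp_all add: Psi_Q_def)

lemma Psi_Q_unitary:
  assumes "c\<^sup>2 + s1\<^sup>2 + s2\<^sup>2 = 1"
  shows "Psi_Q (c, s1, s2) ** ctransp (Psi_Q (c, s1, s2)) = mat 1"
  using assms
  by (simp add: vec_eq_iff forall_2 matrix_mult_2 ctransp_def mat_def complex_eq_iff power2_eq_square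
     algebra_simps)

text \<open>The vector r(\<theta>,\<phi>) as a polynomial in the sphere parameters, so that the
  matrix identities can be verified without trigonometry.\<close>

definition rot_vec :: "real \<times> real \<times> real \<Rightarrow> real^3" where
  "rot_vec = (\<lambda>(c, s1, s2). vector [c\<^sup>2 - s1\<^sup>2 - s2\<^sup>2, - 2 * c * s1, - 2 * c * s2])"

lemma angles_unit: "(cos \<theta>)\<^sup>2 + (sin \<theta> * cos \<phi>)\<^sup>2 + (sin \<theta> * sin \<phi>)\<^sup>2 = (1 :: real)"
proof -
  have "(sin \<theta> * cos \<phi>)\<^sup>2 + (sin \<theta> * sin \<phi>)\<^sup>2 = (sin \<theta>)\<^sup>2 * ((sin \<phi>)\<^sup>2 + (cos \<phi>)\<^sup>2)"
    by (simp only: power_mult_distrib distrib_left add.commute)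
  then show ?thesis
    using sin_cos_squared_add2 [of \<theta>] by (simp only: sin_cos_squared_add mult_1_right add.assoc)
qed

lemma rot_vec_angles: "rot_vec (cos \<theta>, sin \<theta> * cos \<phi>, sin \<theta> * sin \<phi>) = r_vec \<theta> \<phi>"
proof -
  have "(cos \<theta>)\<^sup>2 - (sin \<theta> * cos \<phi>)\<^sup>2 - (sin \<theta> * sin \<phi>)\<^sup>2 = (cos \<theta>)\<^sup>2 - (sin \<theta>)\<^sup>2"
    using angles_unit [of \<theta> \<phi>] sin_cos_squared_add2 [of \<theta>] by linarith
  then show ?thesis
    by (simp add: rot_vec_def r_vec_def vec_eq_iff forall_3 cos_double sin_double)
qed

definition rdot :: "real^3 \<Rightarrow> complex^3 \<Rightarrow> complex" where
  "rdot r z = (\<Sum>a\<in>UNIV. of_real (r $ a) * z $ a)"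

text \<open>For real r the form of Re(z z^H) at r is the squared modulus of the unconjugated pairing
  \<open>rdot r z\<close>.\<close>

lemma Gam_form:
  "r \<bullet> (Gam S L B X i j *v r) =
    rho S / 2 * (\<Sum>l = 1..L. (cmod (rdot r (z_vec S i j (W_mat S (B l) X))))\<^sup>2)"
proof -
  have "(cmod (rdot r z))\<^sup>2 = (\<Sum>a\<in>UNIV. \<Sum>b\<in>UNIV. r $ a * r $ b * Re (z $ a * cnj (z $ b)))" for z
  proof -
    have "(cmod (rdot r z))\<^sup>2 = Re (rdot r z * cnj (rdot r z))"
      by (simp add: complex_mult_cnj cmod_power2)
    also have "\<dots> = (\<Sum>a\<in>UNIV. \<Sum>b\<in>UNIV. r $ a * r $ b * Re (z $ a * cnj (z $ b)))"
      by (simp add: rdot_def sum_3 algebra_simps)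
    finally show ?thesis .
  qed
  then have "(\<Sum>l = 1..L. (cmod (rdot r (z_vec S i j (W_mat S (B l) X))))\<^sup>2) =
     (\<Sum>a\<in>UNIV. \<Sum>b\<in>UNIV. r $ a * r $ b *
       (\<Sum>l = 1..L. Re (z_vec S i j (W_mat S (B l) X) $ a * cnj (z_vec S i j (W_mat S (B l) X) $ b))))"
    by (simp only: sum.swap [of _ "{1..L}"] sum_distrib_left)
  then show ?thesis
    by (simp add: Gam_def inner_vec_def matrix_vector_mult_def sum_3 algebra_simps)
qed

lemma transpose_Gam: "transpose (Gam S L B X i j) = Gam S L B X i j"
  by (simp add: vec_eq_iff transpose_def Gam_def mult.commute)

lemma cmod_sum_diff: "(cmod a)\<^sup>2 + (cmod b)\<^sup>2 = ((cmod (a + b))\<^sup>2 + (cmod (a - b))\<^sup>2) / 2"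
  unfolding cmod_power2 by (simp add: power2_eq_square field_simps)

lemma Re_mult_cnj: "Re (z * cnj z) = (cmod z)\<^sup>2"
  unfolding cmod_power2 by (simp add: power2_eq_square)

lemma Complex_cnj: "Complex x (- y) = cnj (Complex x y)"
  by (simp add: complex_eq_iff)

text \<open>In each case the congruence preserves one linear combination of a pair of entries and
  sends its partner to the pairing of r with z; the parallelogram identity then converts to squared
  moduli.\<close>

lemma diag_conj_Psi_Q:
  fixes c s1 s2 :: real and S :: star_kind and K :: "complex^2^2"
  assumes unit: "c\<^sup>2 + s1\<^sup>2 + s2\<^sup>2 = 1"
  defines "K' \<equiv> star S (Psi_Q (c, s1, s2)) ** K ** Psi_Q (c, s1, s2)"
  shows "(cmod (K'$1$1))\<^sup>2 + (cmod (K'$2$2))\<^sup>2 - ((cmod (K$1$1))\<^sup>2 + (cmod (K$2$2))\<^sup>2) =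
    rho S / 2 * ((cmod (rdot (rot_vec (c, s1, s2)) (z_vec S 1 2 K)))\<^sup>2 - (cmod (z_vec S 1 2 K $ 1))\<^sup>2)"
proof -
  define C where "C = complex_of_real c"
  define w where "w = Complex s1 s2"
  have one: "C * C + w * cnj w = 1"
    using unit by (simp add: C_def w_def complex_eq_iff power2_eq_square algebra_simps)
  have P: "Psi_Q (c, s1, s2) $ 1 $ 1 = C" "Psi_Q (c, s1, s2) $ 1 $ 2 = - w"
    "Psi_Q (c, s1, s2) $ 2 $ 1 = cnj w" "Psi_Q (c, s1, s2) $ 2 $ 2 = C" "cnj C = C"
    by (simp_all add: C_def w_def Complex_cnj)
  have r: "complex_of_real (c\<^sup>2 - s1\<^sup>2 - s2\<^sup>2) = C * C - w * cnj w"
    by (simp add: C_def w_def complex_eq_iff power2_eq_square)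
  show ?thesis
  proof (cases S)
    case Herm
    \<comment> \<open>The invariant combination is the trace, since the congruence is a similarity
      by a unitary matrix.\<close>
    have "K'$1$1 + K'$2$2 = (C * C + w * cnj w) * (K$1$1 + K$2$2)"
      by (simp add: K'_def Herm matrix_mult_2 ctransp_def P algebra_simps del: Psi_Q_nth)
    then have 1: "K'$1$1 + K'$2$2 = K$1$1 + K$2$2"
      by (simp add: one)
    have "K'$2$2 - K'$1$1 = (C * C - w * cnj w) * (K$2$2 - K$1$1) - 2 * C * (cnj w * K$1$2 + w * K$2$1)"
      by (simp add: K'_def Herm matrix_mult_2 ctransp_def P algebra_simps del: Psi_Q_nth)
    also have "\<dots> = rdot (rot_vec (c, s1, s2)) (z_vec S 1 2 K)"
      by (simp add: rdot_def sum_3 rot_vec_def Herm r [symmetric] C_def w_def)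
        (simp add: complex_eq_iff power2_eq_square algebra_simps)
    finally have 2: "cmod (K'$1$1 - K'$2$2) = cmod (rdot (rot_vec (c, s1, s2)) (z_vec S 1 2 K))"
      by (metis norm_minus_commute)
    have 3: "cmod (K$1$1 - K$2$2) = cmod (z_vec S 1 2 K $ 1)"
      by (simp add: Herm norm_minus_commute)
    show ?thesis
      unfolding cmod_sum_diff [of "K'$1$1"] cmod_sum_diff [of "K$1$1"] 1 2 3
      by (simp add: Herm field_simps del: z_vec.simps)
  next
    case Transp
    \<comment> \<open>Under a transpose congruence the skew part is multiplied by the determinant of
      the rotation, which is 1.\<close>
    have "K'$1$2 - K'$2$1 = (C * C + w * cnj w) * (K$1$2 - K$2$1)"
      by (simp add: K'_def Transp matrix_mult_2 transpose_def P algebra_simps del: Psi_Q_nth)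
    then have 1: "K'$1$2 - K'$2$1 = K$1$2 - K$2$1"
      by (simp add: one)
    have "K'$1$2 + K'$2$1 = (C * C - w * cnj w) * (K$1$2 + K$2$1) - 2 * C * (w * K$1$1 - cnj w * K$2$2)"
      by (simp add: K'_def Transp matrix_mult_2 transpose_def P algebra_simps del: Psi_Q_nth)
    also have "\<dots> = rdot (rot_vec (c, s1, s2)) (z_vec S 1 2 K)"
      by (simp add: rdot_def sum_3 rot_vec_def Transp r [symmetric] C_def w_def)
        (simp add: complex_eq_iff power2_eq_square algebra_simps)
    finally have 2: "K'$1$2 + K'$2$1 = rdot (rot_vec (c, s1, s2)) (z_vec S 1 2 K)" .
    have 3: "K$1$2 + K$2$1 = z_vec S 1 2 K $ 1"
      by (simp add: Transp)
    \<comment> \<open>The identity now concerns the off-diagonal entries; invariance of the norm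
      carries it to the diagonal with the opposite sign, which is why rho is -1 here.\<close>
    have "(norm K')\<^sup>2 = (norm K)\<^sup>2"
      unfolding K'_def by (simp add: norm_conj_unitary [OF Psi_Q_unitary [OF unit]])
    moreover have "(cmod (K'$1$2))\<^sup>2 + (cmod (K'$2$1))\<^sup>2 - ((cmod (K$1$2))\<^sup>2 + (cmod (K$2$1))\<^sup>2) =
      ((cmod (rdot (rot_vec (c, s1, s2)) (z_vec S 1 2 K)))\<^sup>2 - (cmod (z_vec S 1 2 K $ 1))\<^sup>2) / 2"
      unfolding cmod_sum_diff [of "K'$1$2"] cmod_sum_diff [of "K$1$2"] 1 2 3
      by (simp add: diff_divide_distrib add_divide_distrib)
    ultimately show ?thesis
      by (simp only: norm_matrix_power2 sum_2 Transp rho.simps)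
  qed
qed

lemma cost_mult_Psi_Q:
  fixes c s1 s2 :: real and X :: "complex^'n::finite^'n" and S :: star_kind and L :: nat and B :: "nat \<Rightarrow> complex^'n^'n"
    and i j :: 'n
  assumes "i \<noteq> j" and unit: "c\<^sup>2 + s1\<^sup>2 + s2\<^sup>2 = 1"
  defines "G \<equiv> Gam S L B X i j" and "r \<equiv> rot_vec (c, s1, s2)"
  shows "elem_fun (cost S L B) X i j Psi_Q (c, s1, s2) = cost S L B X - (r \<bullet> (G *v r) - G$1$1)"
proof -
  let ?E = "elem_mat i j (Psi_Q (c, s1, s2))"
  let ?W = "\<lambda>l. W_mat S (B l) X"
  let ?z = "\<lambda>l. z_vec S i j (?W l)"
  have "?E ** ctransp ?E = mat 1"
    by (simp add: ctransp_elem_mat elem_mat_mult Psi_Q_unitary elem_mat_1 assms)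
  note norm = norm_conj_unitary [OF this]
  have step: "(norm (offdiag (star S ?E ** ?W l ** ?E)))\<^sup>2 =
    (norm (offdiag (?W l)))\<^sup>2 - rho S / 2 * ((cmod (rdot r (?z l)))\<^sup>2 - (cmod (?z l $ 1))\<^sup>2)" for l
  proof -
    let ?V = "star S ?E ** ?W l ** ?E"
    have V: "?V $ p $ p = ?W l $ p $ p" if "p \<in> UNIV - {i, j}" for p
      using that by (simp add: matrix_mult_elem_mat [OF assms(1)] star_elem_mat_mult [OF assms(1)])
    have "(cmod (?V$i$i))\<^sup>2 + (cmod (?V$j$j))\<^sup>2 - ((cmod (?W l$i$i))\<^sup>2 + (cmod (?W l$j$j))\<^sup>2) =
       rho S / 2 * ((cmod (rdot r (?z l)))\<^sup>2 - (cmod (?z l $ 1))\<^sup>2)"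
      using diag_conj_Psi_Q [OF unit, of S "block i j (?W l)"]
      by (simp add: block_conj_elem_mat [OF assms(1), symmetric] z_vec_block [symmetric] r_def)
    moreover have "(\<Sum>p\<in>UNIV - {i, j}. (cmod (?V $ p $ p))\<^sup>2) = (\<Sum>p\<in>UNIV - {i, j}. (cmod (?W l $ p $ p))\<^sup>2)"
      by (rule sum.cong) (simp_all only: V)
    ultimately show ?thesis
      unfolding norm_offdiag_power2 norm sum_split_pair [OF assms(1), of "\<lambda>p. (cmod (_ $ p $ p))\<^sup>2"]
      by linarith
  qed
  have G11: "G$1$1 = rho S / 2 * (\<Sum>l = 1..L. (cmod (?z l $ 1))\<^sup>2)"
    by (simp only: G_def Gam_def vec_lambda_beta Re_mult_cnj)
  show ?thesis
    unfolding elem_fun_def cost_mult step G11 unfolding G_def Gam_form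
    by (simp only: sum_subtractf sum_distrib_left cost_def right_diff_distrib)
qed

text \<open>Cauchy-Schwarz, together with the parallelogram bound of the squared norm of z by twice
  that of W; the factor 2 cancels the 1/2 in \<open>Gam\<close>.\<close>

lemma Gam_form_bound:
  fixes X :: "complex^'n::finite^'n"
  assumes "i \<noteq> j" and C: "(\<Sum>l = 1..L. (norm (W_mat S (B l) X))\<^sup>2) \<le> C"
  shows "\<bar>y \<bullet> (Gam S L B X i j *v y)\<bar> \<le> C * (norm y)\<^sup>2"
proof -
  let ?z = "\<lambda>l. z_vec S i j (W_mat S (B l) X)"
  have "(cmod (rdot y (z_vec S i j W)))\<^sup>2 \<le> (norm y)\<^sup>2 * (2 * (norm W)\<^sup>2)" for W
  proof -
    let ?z = "z_vec S i j W"
    have "cmod (rdot y ?z) \<le> (\<Sum>a\<in>UNIV. \<bar>norm (y $ a)\<bar> * \<bar>norm (?z $ a)\<bar>)"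
      unfolding rdot_def by (rule order_trans [OF norm_sum]) (simp add: norm_mult)
    also have "\<dots> \<le> norm y * norm ?z"
      unfolding norm_vec_def by (rule L2_set_mult_ineq)
    finally have "(cmod (rdot y ?z))\<^sup>2 \<le> (norm y)\<^sup>2 * (norm ?z)\<^sup>2"
      by (metis norm_ge_zero power_mono power_mult_distrib)
    also have "(norm ?z)\<^sup>2 = (\<Sum>a\<in>UNIV. (cmod (?z $ a))\<^sup>2)"
      by (simp add: norm_vec_def L2_set_def sum_nonneg)
    also have "\<dots> \<le> 2 * ((cmod (W$i$i))\<^sup>2 + (cmod (W$i$j))\<^sup>2 + (cmod (W$j$i))\<^sup>2 + (cmod (W$j$j))\<^sup>2)"
      using cmod_sum_diff [of "W$i$i" "W$j$j"] cmod_sum_diff [of "W$i$j" "W$j$i"]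
      by (cases S; simp add: sum_3 norm_mult norm_minus_commute;
          insert zero_le_power2 [of "cmod (W$i$i + W$j$j)"] zero_le_power2 [of "cmod (W$i$j - W$j$i)"];
          linarith)
    also have "\<dots> \<le> 2 * (norm W)\<^sup>2"
      by (subst norm_matrix_power2_split [OF assms(1)]) (simp add: sum_nonneg)
    finally show ?thesis
      by (simp add: mult_left_mono)
  qed
  then have "(\<Sum>l = 1..L. (cmod (rdot y (?z l)))\<^sup>2) \<le>
      (\<Sum>l = 1..L. (norm y)\<^sup>2 * (2 * (norm (W_mat S (B l) X))\<^sup>2))"
    by (intro sum_mono)
  also have "\<dots> = 2 * (norm y)\<^sup>2 * (\<Sum>l = 1..L. (norm (W_mat S (B l) X))\<^sup>2)"
    by (simp add: sum_distrib_left mult_ac)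
  also have "\<dots> \<le> 2 * (norm y)\<^sup>2 * C"
    using C by (intro mult_left_mono) auto
  finally have "(\<Sum>l = 1..L. (cmod (rdot y (?z l)))\<^sup>2) \<le> 2 * (C * (norm y)\<^sup>2)"
    by (simp add: mult_ac)
  moreover have "\<bar>rho S\<bar> = 1"
    by (cases S) auto
  ultimately show ?thesis
    by (simp add: Gam_form abs_mult sum_nonneg)
qed

text \<open>The formula for h holds on the sphere only, so the derivative is computed along great
  circles through (1, 0, 0). They reach all tangent directions, and the projection discards the
  radial one.\<close>

lemma sphere_grad_Psi_Q:
  fixes X :: "complex^'n::finite^'n" and S :: star_kind and L :: nat and B :: "nat \<Rightarrow> complex^'n^'n"
    and i j :: 'n
  assumes "i \<noteq> j"
  defines "G \<equiv> Gam S L B X i j"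
  shows "sphere_grad (elem_fun (cost S L B) X i j Psi_Q) (1, 0, 0) = (0, 4 * G$1$2, 4 * G$1$3)"
proof -
  let ?h = "elem_fun (cost S L B) X i j Psi_Q"
  \<comment> \<open>\<open>elem_mat\<close> depends affinely on the sphere parameters; subtracting
    its value at 0 leaves a linear map, and differentiability of h on the ambient space
    follows.\<close>
  let ?L = "\<lambda>a. elem_mat i j (Psi_Q a) - elem_mat i j (Psi_Q (0, 0, 0)) :: complex^'n^'n"
  have "?L (a + b) $ p $ q = ?L a $ p $ q + ?L b $ p $ q" "?L (r *\<^sub>R a) $ p $ q = r *\<^sub>R ?L a $ p $ q"
    for a b r p q
    by (cases a; cases b; cases "p = i"; cases "p = j"; cases "q = i"; cases "q = j";
        simp add: elem_mat_def complex_eq_iff algebra_simps)+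
  then have "linear ?L"
    by (intro linearI) (simp_all only: vec_eq_iff vector_add_component vector_scaleR_component, simp_all)
  then have "(\<lambda>a. elem_mat i j (Psi_Q a) - elem_mat i j (Psi_Q (0, 0, 0)) :: complex^'n^'n) differentiable at x" for x
    by (simp add: linear_conv_bounded_linear bounded_linear_imp_differentiable)
  then have "(\<lambda>a. (elem_mat i j (Psi_Q a) - elem_mat i j (Psi_Q (0, 0, 0))) + elem_mat i j (Psi_Q (0, 0, 0)) :: complex^'n^'n)
      differentiable at x" for x
    by (intro differentiable_add differentiable_const)
  from this [of "(1, 0, 0)"]
  obtain D1 where D1: "((\<lambda>a. elem_mat i j (Psi_Q a) :: complex^'n^'n) has_derivative D1) (at (1, 0, 0))"
    unfolding differentiable_def by auto
  have "((\<lambda>a. X ** elem_mat i j (Psi_Q a)) has_derivative (\<lambda>a. X ** D1 a)) (at (1, 0, 0))"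
    by (rule bounded_linear.has_derivative
        [OF bounded_bilinear.bounded_linear_right [OF bounded_bilinear_matrix_mult] D1])
  then have "((\<lambda>a. cost S L B (X ** elem_mat i j (Psi_Q a))) has_derivative
      (\<lambda>a. cost_deriv S L B (X ** elem_mat i j (Psi_Q (1, 0, 0))) (X ** D1 a))) (at (1, 0, 0))"
    by (rule has_derivative_compose [where g = "cost S L B"]) (rule has_derivative_cost)
  then obtain D where "((\<lambda>a. cost S L B (X ** elem_mat i j (Psi_Q a))) has_derivative D) (at (1, 0, 0))"
    by blast
  then have D: "(?h has_derivative D) (at (1, 0, 0))"
    unfolding elem_fun_def [abs_def] .
  \<comment> \<open>At t = 0 the squared cosine and sine have slope 0, so only the mixed term
    contributes.\<close>
  have trig: "((\<lambda>t. K - ((cos (2 * t))\<^sup>2 * g - 2 * sin (2 * t) * cos (2 * t) * s + (sin (2 * t))\<^sup>2 * q - g))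
      has_field_derivative 4 * s) (at 0)" for K g s q :: real
    by (rule derivative_eq_intros refl | simp)+
  have dir: "D (0, cos \<phi>, sin \<phi>) = 4 * (G$1$2 * cos \<phi> + G$1$3 * sin \<phi>)" for \<phi>
  proof -
    let ?\<gamma> = "\<lambda>t. (cos t, sin t * cos \<phi>, sin t * sin \<phi>)"
    let ?v = "(0, cos \<phi>, sin \<phi>)"
    have "(?\<gamma> has_derivative (\<lambda>t. t *\<^sub>R ?v)) (at 0)"
      by (auto intro!: derivative_eq_intros)
    then have "((\<lambda>t. ?h (?\<gamma> t)) has_derivative (\<lambda>t. D (t *\<^sub>R ?v))) (at 0)"
      by (rule has_derivative_compose) (use D in simp)
    moreover have "D (t *\<^sub>R ?v) = t * D ?v" for t
      using linear_cmul [OF has_derivative_linear [OF D], of t ?v] by simp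
    ultimately have 1: "((\<lambda>t. ?h (?\<gamma> t)) has_field_derivative D ?v) (at 0)"
      by (simp add: has_field_derivative_def mult_commute_abs)
    have "?h (?\<gamma> t) = cost S L B X - (r_vec t \<phi> \<bullet> (G *v r_vec t \<phi>) - G$1$1)" for t
      unfolding cost_mult_Psi_Q [OF assms(1) angles_unit] rot_vec_angles G_def ..
    then have "((\<lambda>t. ?h (?\<gamma> t)) has_field_derivative 4 * (G$1$2 * cos \<phi> + G$1$3 * sin \<phi>)) (at 0)"
      unfolding G_def by (simp only: r_vec_form [OF transpose_Gam] trig)
    with 1 show ?thesis
      by (rule DERIV_unique)
  qed
  have "euclid_grad ?h (1, 0, 0) \<bullet> (0, 1, 0) = 4 * G$1$2" "euclid_grad ?h (1, 0, 0) \<bullet> (0, 0, 1) = 4 * G$1$3"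
    using dir [of 0] dir [of "pi / 2"] by (simp_all add: euclid_grad_inner [OF D])
  then show ?thesis
    by (cases "euclid_grad ?h (1, 0, 0)") (simp add: sphere_grad_def)
qed

text \<open>The squared gradient is 16 times the sum of squares in \<open>step_Q_increase\<close>,
  hence 128C = 16 * 8C.\<close>

lemma sufficient_decrease_Q:
  fixes X :: "complex^'n::finite^'n"
  assumes "i \<noteq> j" and C: "(\<Sum>l = 1..L. (norm (W_mat S (B l) X))\<^sup>2) \<le> C" "C > 0"
    and step: "step_Q \<sigma> (Gam S L B X i j) \<theta> \<phi>"
    and P: "P = Psi_Q (cos \<theta>, sin \<theta> * cos \<phi>, sin \<theta> * sin \<phi>)"
  shows "(norm (sphere_grad (elem_fun (cost S L B) X i j Psi_Q) (1, 0, 0)))\<^sup>2 / (128 * C)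
    \<le> cost S L B X - cost S L B (X ** elem_mat i j P)"
proof -
  have "cost S L B (X ** elem_mat i j P) =
      cost S L B X - (r_vec \<theta> \<phi> \<bullet> (Gam S L B X i j *v r_vec \<theta> \<phi>) - Gam S L B X i j $ 1 $ 1)"
    using cost_mult_Psi_Q [OF assms(1) angles_unit [of \<theta> \<phi>], where S = S and L = L and B = B and X = X]
    unfolding elem_fun_def rot_vec_angles P .
  moreover have "(norm (sphere_grad (elem_fun (cost S L B) X i j Psi_Q) (1, 0, 0)))\<^sup>2 / (128 * C) =
      ((Gam S L B X i j $ 1 $ 2)\<^sup>2 + (Gam S L B X i j $ 1 $ 3)\<^sup>2) / (8 * C)"
    by (simp add: sphere_grad_Psi_Q [OF assms(1)] norm_Pair power_mult_distrib add_divide_distrib)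
  ultimately show ?thesis
    using step_Q_increase [OF transpose_Gam Gam_form_bound [OF assms(1) C(1)] C(2) step] by simp
qed

subsection \<open>Convergence\<close>

lemma cost_nonneg: "cost S L B X \<ge> 0"
  by (simp add: cost_def sum_nonneg)

lemma elem_update_det:
  fixes X :: "complex^'n::finite^'n"
  assumes "i \<noteq> j" and \<sigma>: "0 < \<sigma>\<^sub>D" "\<sigma>\<^sub>D < 1 / 4" and up: "elem_update S L B \<sigma>\<^sub>D \<sigma>\<^sub>Q X i j \<tau> P"
  shows "det P = 1"
proof (cases \<tau>)
  case TypeU
  then show ?thesis
    using up by (auto simp: Psi_U_def det_2)
next
  case TypeL
  then show ?thesis
    using up by (auto simp: Psi_L_def det_2)
next
  case TypeD
  define x where "x = step_D \<sigma>\<^sub>D (gam S L B X i j i) (gam S L B X i j j)"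
  \<comment> \<open>Any positive bound will do here: the sum plus 1 serves as C in order to obtain a
    positive, hence nonzero, step.\<close>
  have "gam S L B X i j i + gam S L B X i j j \<le> gam S L B X i j i + gam S L B X i j j + 1"
    "gam S L B X i j i + gam S L B X i j j + 1 > 0"
    using gam_nonneg [of S L B X i j i] gam_nonneg [of S L B X i j j] by linarith+
  from step_D_decrease(1) [OF \<sigma> gam_nonneg gam_nonneg this] have "Complex x 0 \<noteq> 0"
    unfolding x_def [symmetric] by (simp add: complex_eq_iff)
  moreover have "P = Psi_D (x, 0)"
    using up TypeD by (simp add: x_def)
  ultimately show ?thesis
    by (simp add: Psi_D_def det_2)
next
  case TypeQ
  then obtain \<theta> \<phi> where P: "P = Psi_Q (cos \<theta>, sin \<theta> * cos \<phi>, sin \<theta> * sin \<phi>)"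
    using up by auto
  show ?thesis
    using angles_unit [of \<theta> \<phi>] unfolding P det_2 Psi_Q_nth
    by (simp add: complex_eq_iff power2_eq_square)
qed

lemma elem_update_sufficient_decrease:
  fixes X :: "complex^'n::finite^'n"
  assumes "i \<noteq> j" and C: "(\<Sum>l = 1..L. (norm (W_mat S (B l) X))\<^sup>2) \<le> C" "C > 0"
    and \<sigma>: "0 < \<sigma>\<^sub>D" "\<sigma>\<^sub>D < 1 / 4"
    and up: "elem_update S L B \<sigma>\<^sub>D \<sigma>\<^sub>Q X i j \<tau> P"
  shows "(1 - 4 * \<sigma>\<^sub>D) / (128 * C) * (elem_grad_norm (cost S L B) X i j \<tau>)\<^sup>2
    \<le> cost S L B X - cost S L B (X ** elem_mat i j P)"
proof -
  let ?d = "cost S L B X - cost S L B (X ** elem_mat i j P)"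
  let ?n = "elem_grad_norm (cost S L B) X i j \<tau>"
  have "(1 - 4 * \<sigma>\<^sub>D) / (128 * C) * ?n\<^sup>2 \<le> a * ?n\<^sup>2"
    if "(1 - 4 * \<sigma>\<^sub>D) / (128 * C) \<le> a" for a
    using that by (rule mult_right_mono) simp
  moreover have "(1 - 4 * \<sigma>\<^sub>D) / (128 * C) \<le> 1 / (16 * C)" "(1 - 4 * \<sigma>\<^sub>D) / (128 * C) \<le> 1 / (128 * C)"
    "(1 - 4 * \<sigma>\<^sub>D) / (128 * C) \<le> (1 - 4 * \<sigma>\<^sub>D) / (8 * C)"
    using \<sigma> \<open>C > 0\<close> by (auto intro!: frac_le)
  moreover have "1 / (16 * C) * ?n\<^sup>2 \<le> ?d \<or> 1 / (128 * C) * ?n\<^sup>2 \<le> ?d \<or>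
    (1 - 4 * \<sigma>\<^sub>D) / (8 * C) * ?n\<^sup>2 \<le> ?d"
  proof (cases \<tau>)
    case TypeU
    then show ?thesis
      using up sufficient_decrease_U [OF assms(1) C] by auto
  next
    case TypeL
    then show ?thesis
      using up sufficient_decrease_L [OF assms(1) C] by auto
  next
    case TypeD
    then show ?thesis
      using up sufficient_decrease_D [OF assms(1) C \<sigma>] by auto
  next
    case TypeQ
    then show ?thesis
      using up sufficient_decrease_Q [OF assms(1) C] by auto
  qed
  ultimately show ?thesis
    by (meson order_trans)
qed

text \<open>The stopping test is phrased with the Riemannian gradient, the decrease with \<Lambda>;
  invertibility of X cancels the factor between them.\<close>

lemma Lam_eq_0:
  assumes "X \<in> SL" "rgrad g X = 0"
  shows "Lam g X = 0"
proof -
  have "invertible X"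
    using assms(1) by (simp add: SL_def invertible_det_nz)
  then obtain Y where "Y ** X = mat 1"
    by (auto simp: invertible_def)
  then have "Lam g X = Y ** (X ** Lam g X)"
    by (simp add: matrix_mul_assoc)
  then show ?thesis
    using assms(2) by (simp add: rgrad_def)
qed

lemma jacobi_step_SL:
  assumes "0 < \<sigma>\<^sub>D" "\<sigma>\<^sub>D < 1 / 4" "X \<in> SL" "jacobi_step T S L B \<sigma>\<^sub>D \<sigma>\<^sub>Q \<epsilon> X X'"
  shows "X' \<in> SL"
proof (cases "rgrad (cost S L B) X = 0")
  case True
  then show ?thesis
    using assms by (simp add: jacobi_step_def)
next
  case False
  then obtain i j \<tau> P where "i < j" "elem_update S L B \<sigma>\<^sub>D \<sigma>\<^sub>Q X i j \<tau> P" "X' = X ** elem_mat i j P"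
    using assms(4) unfolding jacobi_step_def by auto
  then show ?thesis
    using assms(1-3) elem_update_det [of i j] by (simp add: SL_def det_mul det_elem_mat)
qed

lemma jacobi_step_sufficient_decrease:
  assumes C: "(\<Sum>l = 1..L. (norm (W_mat S (B l) X))\<^sup>2) \<le> C" "C > 0"
    and \<sigma>: "0 < \<sigma>\<^sub>D" "\<sigma>\<^sub>D < 1 / 4" and "\<epsilon> > 0" and "X \<in> SL"
    and step: "jacobi_step T S L B \<sigma>\<^sub>D \<sigma>\<^sub>Q \<epsilon> X X'"
  shows "(1 - 4 * \<sigma>\<^sub>D) / (128 * C) * \<epsilon>\<^sup>2 * (norm (Lam (cost S L B) X))\<^sup>2 \<le> cost S L B X - cost S L B X'"
proof (cases "rgrad (cost S L B) X = 0")
  case True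
  then show ?thesis
    using step Lam_eq_0 [OF \<open>X \<in> SL\<close> True] by (simp add: jacobi_step_def)
next
  case False
  then obtain i j \<tau> P where *: "i < j" "elem_update S L B \<sigma>\<^sub>D \<sigma>\<^sub>Q X i j \<tau> P" "X' = X ** elem_mat i j P"
    and ge: "\<epsilon> * norm (Lam (cost S L B) X) \<le> elem_grad_norm (cost S L B) X i j \<tau>"
    using step unfolding jacobi_step_def by auto
  have "(\<epsilon> * norm (Lam (cost S L B) X))\<^sup>2 \<le> (elem_grad_norm (cost S L B) X i j \<tau>)\<^sup>2"
    using ge \<open>\<epsilon> > 0\<close> by (intro power_mono) auto
  then have "(1 - 4 * \<sigma>\<^sub>D) / (128 * C) * (\<epsilon> * norm (Lam (cost S L B) X))\<^sup>2 \<le>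
      (1 - 4 * \<sigma>\<^sub>D) / (128 * C) * (elem_grad_norm (cost S L B) X i j \<tau>)\<^sup>2"
    using \<sigma> C(2) by (intro mult_left_mono) auto
  also have "\<dots> \<le> cost S L B X - cost S L B X'"
    unfolding \<open>X' = _\<close> using *(1) by (intro elem_update_sufficient_decrease [OF _ C \<sigma> *(2)]) auto
  finally show ?thesis
    by (simp only: power_mult_distrib mult.assoc)
qed

text \<open>Compactness of the closed ball gives one constant for all iterates in it, without an
  explicit estimate in terms of M.\<close>

lemma W_mat_bound:
  obtains C where "C > 0"
    "\<And>X :: complex^'n::finite^'n. norm X \<le> M \<Longrightarrow> (\<Sum>l = 1..L. (norm (W_mat S (B l) X))\<^sup>2) \<le> C"
proof -
  let ?f = "\<lambda>X :: complex^'n^'n. \<Sum>l = 1..L. (norm (W_mat S (B l) X))\<^sup>2"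
  have "continuous_on (cball 0 M) ?f"
    by (intro continuous_intros continuous_on_subset [OF continuous_on_W_mat]) auto
  then have "bounded (?f ` cball 0 M)"
    by (intro compact_imp_bounded compact_continuous_image compact_cball)
  then obtain C where "C > 0" and C: "\<And>Y. Y \<in> ?f ` cball 0 M \<Longrightarrow> norm Y \<le> C"
    unfolding bounded_pos by blast
  have "?f X \<le> C" if "norm X \<le> M" for X
  proof -
    have "norm (?f X) \<le> C"
      using that by (intro C imageI) simp
    then show ?thesis
      unfolding real_norm_def by (rule abs_le_D1)
  qed
  then show ?thesis
    using that \<open>C > 0\<close> by blast
qed

lemma jacobi_run_step:
  assumes "jacobi_run T S L B \<sigma>\<^sub>D \<sigma>\<^sub>Q \<epsilon> X"
  shows "jacobi_step T S L B \<sigma>\<^sub>D \<sigma>\<^sub>Q \<epsilon> (X k) (X (Suc k))"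
proof -
  have "\<forall>k\<ge>1. jacobi_step T S L B \<sigma>\<^sub>D \<sigma>\<^sub>Q \<epsilon> (X (k - 1)) (X k)"
    using assms unfolding jacobi_run_def by (rule conjunct2)
  from this [rule_format, of "Suc k"] show ?thesis
    by simp
qed

lemma Lam_jacobi_run_tendsto_0:
  assumes \<sigma>: "0 < \<sigma>\<^sub>D" "\<sigma>\<^sub>D < 1 / 4" and "\<epsilon> > 0" and run: "jacobi_run T S L B \<sigma>\<^sub>D \<sigma>\<^sub>Q \<epsilon> X"
    and SL: "\<And>k. X k \<in> SL" and bd: "\<forall>k\<ge>1. norm (X k) \<le> M"
  shows "(\<lambda>k. Lam (cost S L B) (X (Suc k))) \<longlonglongrightarrow> 0"
proof -
  obtain C where C: "C > 0" "\<And>Y. norm Y \<le> M \<Longrightarrow> (\<Sum>l = 1..L. (norm (W_mat S (B l) Y))\<^sup>2) \<le> C"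
    using W_mat_bound by blast
  define \<kappa> where "\<kappa> = (1 - 4 * \<sigma>\<^sub>D) / (128 * C) * \<epsilon>\<^sup>2"
  have "\<kappa> > 0"
    using \<sigma> C(1) \<open>\<epsilon> > 0\<close> by (simp add: \<kappa>_def)
  \<comment> \<open>The costs are read from index 1 on, because the norm bound does not cover the
    starting point.\<close>
  define a where "a = (\<lambda>k. cost S L B (X (Suc k)))"
  have dec: "\<kappa> * (norm (Lam (cost S L B) (X (Suc k))))\<^sup>2 \<le> a k - a (Suc k)" for k
  proof -
    have "norm (X (Suc k)) \<le> M"
      using bd by simp
    then show ?thesis
      unfolding \<kappa>_def a_def
      by (rule jacobi_step_sufficient_decrease
          [OF C(2) C(1) \<sigma> \<open>\<epsilon> > 0\<close> SL jacobi_run_step [OF run]])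
  qed
  have "decseq a"
  proof (rule decseq_SucI)
    fix k
    have "0 \<le> \<kappa> * (norm (Lam (cost S L B) (X (Suc k))))\<^sup>2"
      using \<open>\<kappa> > 0\<close> by simp
    then show "a (Suc k) \<le> a k"
      using dec [of k] by linarith
  qed
  moreover have "\<forall>k. 0 \<le> a k"
    by (simp add: a_def cost_nonneg)
  ultimately obtain c where "a \<longlonglongrightarrow> c"
    by (rule decseq_convergent)
  then have "(\<lambda>k. (a k - a (Suc k)) / \<kappa>) \<longlonglongrightarrow> (c - c) / \<kappa>"
    using \<open>\<kappa> > 0\<close> by (intro tendsto_intros LIMSEQ_Suc) auto
  then have lim: "(\<lambda>k. (a k - a (Suc k)) / \<kappa>) \<longlonglongrightarrow> 0"
    by simp
  have "(\<lambda>k. (norm (Lam (cost S L B) (X (Suc k))))\<^sup>2) \<longlonglongrightarrow> 0"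
    by (rule tendsto_sandwich [OF _ _ tendsto_const lim])
      (use dec \<open>\<kappa> > 0\<close> in \<open>auto simp: field_simps\<close>)
  then have "(\<lambda>k. norm (Lam (cost S L B) (X (Suc k)))) \<longlonglongrightarrow> 0"
    by (auto dest: tendsto_real_sqrt)
  then show ?thesis
    by (rule tendsto_norm_zero_cancel)
qed

theorem theorem8p4:
  fixes S :: star_kind
    and L :: nat
    and B :: "nat \<Rightarrow> ('n::{finite,linorder}) cmat"
    and \<sigma>\<^sub>D \<sigma>\<^sub>Q \<epsilon> M\<^sub>X :: real
    and X :: "nat \<Rightarrow> 'n cmat"
    and X\<^sub>s :: "'n cmat"
  assumes "CARD('n) \<ge> 2"
    and "L \<ge> 1"
    and "0 < \<sigma>\<^sub>D" and "\<sigma>\<^sub>D < 1 / 4"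
    and "0 < \<sigma>\<^sub>Q" and "\<sigma>\<^sub>Q \<le> 1"
    and "jacobi_GLU S L B \<sigma>\<^sub>D \<sigma>\<^sub>Q \<epsilon> X \<or> jacobi_GQU S L B \<sigma>\<^sub>D \<sigma>\<^sub>Q \<epsilon> X"
    and "M\<^sub>X > 0"
    and "\<forall>k\<ge>1. norm (X k) \<le> M\<^sub>X"
    and "accumulation_point (\<lambda>k. X (Suc k)) X\<^sub>s"
  shows "stationary_on_SL (cost S L B) X\<^sub>s"
proof -
  obtain T where "\<epsilon> > 0" and run: "jacobi_run T S L B \<sigma>\<^sub>D \<sigma>\<^sub>Q \<epsilon> X"
    using assms(7) unfolding jacobi_GLU_def jacobi_GQU_def by blast
  have SL: "X k \<in> SL" for k
  proof (induction k)
    case 0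
    then show ?case
      using run by (simp add: jacobi_run_def)
  next
    case (Suc k)
    show ?case
      by (rule jacobi_step_SL [OF assms(3,4) Suc jacobi_run_step [OF run]])
  qed
  obtain r where r: "strict_mono r" "((\<lambda>k. X (Suc k)) \<circ> r) \<longlonglongrightarrow> X\<^sub>s"
    using assms(10) by (auto simp: accumulation_point_def)
  \<comment> \<open>Stationarity includes det = 1 for the limit, which needs a closedness argument
    of its own.\<close>
  have "closed (SL :: 'n cmat set)"
  proof -
    have "continuous_on UNIV (det :: 'n cmat \<Rightarrow> complex)"
      unfolding det_def [abs_def] by (intro continuous_intros)
    then show ?thesis
      unfolding SL_def by (intro closed_Collect_eq continuous_on_const)
  qed
  then have "X\<^sub>s \<in> SL"
    by (rule closed_sequentially [OF _ _ r(2)]) (simp add: SL)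
  moreover have "Lam (cost S L B) X\<^sub>s = 0"
  proof (rule LIMSEQ_unique)
    show "(\<lambda>k. Lam (cost S L B) (((\<lambda>k. X (Suc k)) \<circ> r) k)) \<longlonglongrightarrow> Lam (cost S L B) X\<^sub>s"
      by (rule continuous_on_tendsto_compose [OF continuous_on_Lam_cost r(2)]) auto
    show "(\<lambda>k. Lam (cost S L B) (((\<lambda>k. X (Suc k)) \<circ> r) k)) \<longlonglongrightarrow> 0"
      using LIMSEQ_subseq_LIMSEQ
        [OF Lam_jacobi_run_tendsto_0 [OF assms(3,4) \<open>\<epsilon> > 0\<close> run SL assms(9)] r(1)]
      by (simp add: o_def)
  qed
  ultimately show ?thesis
    by (simp add: stationary_on_SL_def rgrad_def)
qed

end
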